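(* Let $d\geq 0$ be fixed. There is an algorithm which, given a reduced boolean matrix with $n$ columns defining a simplicial complex of dimension $d$, computes the list of faces of this complex in time $O(n^{2d+1})$. Moreover, the facets can be marked in this list in time $O(n^{2d+2})$.
   Context: A (finite) simplicial complex is a pair $(V,H)$ with $V$ finite nonempty and $H\subseteq 2^V$ containing all singletons and closed under subsets; maximal faces are facets; the dimension of a face $I$ is $|I|-1$ and the dimension of the complex is the maximal dimension of a face. A boolean matrix with row set $R$ and column set $V$ is nonsingular if, after independently permuting rows and columns, it is square lower unitriangular; $X\subseteq V$ is $M$-independent if some submatrix $M[Y,X]$ ($Y\subseteq R$) is nonsingular. A boolean matrix $M$ defines (represents) the complex $(V,H)$ where $H$ is the set of $M$-independent subsets of columns. $M$ is reduced if its rows are pairwise distinct and nonzero. Time is measured as the number of elementary operations, with $d$ treated as a constant. *)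

theory Defs
  imports
    "Jordan_Normal_Form.DL_Submatrix"
    "HOL-Combinatorics.Permutations"
    "HOL-Library.Landau_Symbols"
begin

section \<open>Simplicial complexes\<close>

definition simplicial_complex :: "'a set \<Rightarrow> 'a set set \<Rightarrow> bool" where
  "simplicial_complex V H \<longleftrightarrow>
     finite V \<and> V \<noteq> {} \<and> H \<subseteq> Pow V \<and> (\<forall>v\<in>V. {v} \<in> H) \<and> (\<forall>I\<in>H. \<forall>J. J \<subseteq> I \<longrightarrow> J \<in> H)"

text \<open>Integer-valued, since the empty face has dimension -1.\<close>

definition face_dim :: "'a set \<Rightarrow> int" where
  "face_dim I = int (card I) - 1"

definition complex_dim :: "'a set set \<Rightarrow> int" where
  "complex_dim H = Max (face_dim ` H)"

definition facet :: "'a set set \<Rightarrow> 'a set \<Rightarrow> bool" where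
  "facet H F \<longleftrightarrow> F \<in> H \<and> (\<forall>G\<in>H. F \<subseteq> G \<longrightarrow> G = F)"


section \<open>Boolean matrices\<close>

definition lower_unitriangular :: "bool mat \<Rightarrow> bool" where
  "lower_unitriangular A \<longleftrightarrow>
     square_mat A \<and>
     (\<forall>i<dim_row A. A $$ (i, i)) \<and>
     (\<forall>i<dim_row A. \<forall>j<dim_col A. i < j \<longrightarrow> \<not> A $$ (i, j))"

definition permute_mat :: "(nat \<Rightarrow> nat) \<Rightarrow> (nat \<Rightarrow> nat) \<Rightarrow> 'a mat \<Rightarrow> 'a mat" where
  "permute_mat p q A = mat (dim_row A) (dim_col A) (\<lambda>(i, j). A $$ (p i, q j))"

definition nonsingular :: "bool mat \<Rightarrow> bool" where
  "nonsingular A \<longleftrightarrow>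
     (\<exists>p q. p permutes {..<dim_row A} \<and> q permutes {..<dim_col A} \<and>
            lower_unitriangular (permute_mat p q A))"

text \<open>Rows and columns are identified with their indices. The empty set of columns is
  independent, witnessed by the submatrix with no rows and no columns.\<close>

definition indep_columns :: "bool mat \<Rightarrow> nat set \<Rightarrow> bool" where
  "indep_columns M X \<longleftrightarrow>
     X \<subseteq> {..<dim_col M} \<and> (\<exists>Y \<subseteq> {..<dim_row M}. nonsingular (submatrix M Y X))"

definition defines_complex :: "bool mat \<Rightarrow> nat set \<Rightarrow> nat set set \<Rightarrow> bool" where
  "defines_complex M V H \<longleftrightarrow>
     simplicial_complex V H \<and> V = {..<dim_col M} \<and> H = {X. indep_columns M X}"

definition reduced :: "bool mat \<Rightarrow> bool" where
  "reduced M \<longleftrightarrow>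
     distinct (rows M) \<and> (\<forall>i<dim_row M. row M i \<noteq> vec (dim_col M) (\<lambda>_. False))"


section \<open>A random access machine\<close>

text \<open>Programs of a uniform-cost random access machine whose arithmetic consists of addition
  and truncated subtraction. Multiplication is left out on purpose: at unit cost, repeated
  squaring would make the uniform cost measure unrealistic. Memory is organised as named arrays
  of natural numbers; a program refers to finitely many of them, and \<open>Work k\<close> are the scratch
  arrays. A scalar variable is cell 0 of an array. Each evaluation of a constant, memory read or
  write, arithmetic operation and branch counts as one elementary operation.\<close>

datatype arr = Num_Rows | Num_Cols | Entries | Num_Faces | Faces | Marks | Work nat

type_synonym store = "arr \<Rightarrow> nat \<Rightarrow> nat"

datatype expr = Const nat | Read arr expr | Add expr expr | Sub expr expr

primrec eval_expr :: "expr \<Rightarrow> store \<Rightarrow> nat" where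
  "eval_expr (Const k) s = k"
| "eval_expr (Read a e) s = s a (eval_expr e s)"
| "eval_expr (Add e f) s = eval_expr e s + eval_expr f s"
| "eval_expr (Sub e f) s = eval_expr e s - eval_expr f s"

primrec cost_expr :: "expr \<Rightarrow> nat" where
  "cost_expr (Const k) = 1"
| "cost_expr (Read a e) = 1 + cost_expr e"
| "cost_expr (Add e f) = 1 + cost_expr e + cost_expr f"
| "cost_expr (Sub e f) = 1 + cost_expr e + cost_expr f"

datatype prog =
    Skip
  | Write arr expr expr
  | Seq prog prog
  | Cond expr prog prog
  | While expr prog

text \<open>\<open>run c s t s'\<close>: started in \<open>s\<close>, the program \<open>c\<close> halts in \<open>s'\<close> after exactly \<open>t\<close>
  elementary operations. Tests succeed on nonzero values. There is no derivation for a
  diverging program.\<close>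

inductive run :: "prog \<Rightarrow> store \<Rightarrow> nat \<Rightarrow> store \<Rightarrow> bool" where
  run_Skip: "run Skip s 1 s"
| run_Write:
    "run (Write a i e) s (1 + cost_expr i + cost_expr e)
       (s(a := (s a)(eval_expr i s := eval_expr e s)))"
| run_Seq: "run c s t s' \<Longrightarrow> run c' s' t' s'' \<Longrightarrow> run (Seq c c') s (t + t') s''"
| run_Cond_true:
    "eval_expr e s \<noteq> 0 \<Longrightarrow> run c s t s' \<Longrightarrow> run (Cond e c c') s (1 + cost_expr e + t) s'"
| run_Cond_false:
    "eval_expr e s = 0 \<Longrightarrow> run c' s t s' \<Longrightarrow> run (Cond e c c') s (1 + cost_expr e + t) s'"
| run_While_true:
    "eval_expr e s \<noteq> 0 \<Longrightarrow> run c s t s' \<Longrightarrow> run (While e c) s' t' s'' \<Longrightarrow>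
       run (While e c) s (1 + cost_expr e + t + t') s''"
| run_While_false: "eval_expr e s = 0 \<Longrightarrow> run (While e c) s (1 + cost_expr e) s"

lemma run_deterministic:
  "run c s t s' \<Longrightarrow> run c s u s'' \<Longrightarrow> t = u \<and> s' = s''"
proof (induction arbitrary: u s'' rule: run.induct)
  case (run_Skip s)
  then show ?case by (auto elim: run.cases)
next
  case (run_Write a i e s)
  then show ?case by (auto elim: run.cases)
next
  case (run_Seq c s t s' c' t' s''')
  from run_Seq.prems obtain v v' r where
    "run c s v r" "run c' r v' s''" "u = v + v'"
    by (auto elim: run.cases)
  with run_Seq.IH show ?case by blast
next
  case (run_Cond_true e s c t s' c')
  from run_Cond_true.prems run_Cond_true.hyps show ?case
    by (cases rule: run.cases) (auto dest: run_Cond_true.IH)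
next
  case (run_Cond_false e s c' t s' c)
  from run_Cond_false.prems run_Cond_false.hyps show ?case
    by (cases rule: run.cases) (auto dest: run_Cond_false.IH)
next
  case (run_While_true e s c t s' t' s''')
  from run_While_true.prems run_While_true.hyps obtain v v' r where
    "run c s v r" "run (While e c) r v' s''" "u = 1 + cost_expr e + v + v'"
    by (auto elim: run.cases)
  with run_While_true.IH show ?case by blast
next
  case (run_While_false e s c)
  then show ?case by (auto elim: run.cases)
qed


section \<open>Input and output\<close>

text \<open>The matrix is given by its numbers of rows and columns and its entries (as 0 and 1) in
  row-major order. All other cells are 0.\<close>

definition input_store :: "bool mat \<Rightarrow> store" where
  "input_store M = (\<lambda>a i.
     if a = Num_Rows \<and> i = 0 then dim_row M
     else if a = Num_Cols \<and> i = 0 then dim_col M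
     else if a = Entries \<and> i < dim_row M * dim_col M
       then of_bool (M $$ (i div dim_col M, i mod dim_col M))
     else 0)"

text \<open>A face is written as its cardinality followed by its elements in increasing order; the
  records of the faces follow each other without gaps.\<close>

definition encode_face :: "nat set \<Rightarrow> nat list" where
  "encode_face F = card F # sorted_list_of_set F"

definition stores_faces :: "store \<Rightarrow> nat set list \<Rightarrow> bool" where
  "stores_faces s L \<longleftrightarrow>
     s Num_Faces 0 = length L \<and>
     (let w = concat (map encode_face L) in \<forall>i<length w. s Faces i = w ! i)"

definition stores_marks :: "store \<Rightarrow> nat set set \<Rightarrow> nat set list \<Rightarrow> bool" where
  "stores_marks s H L \<longleftrightarrow> (\<forall>i<length L. s Marks i = of_bool (facet H (L ! i)))"

end

theory Submission
  imports Defs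
begin

text \<open>A set of columns is independent iff it can be emptied by repeatedly deleting a column that carries
  the only 1 of some row among the remaining columns. Independence is hereditary, so the greedy
  order works, and a set of at most \<open>d + 2\<close> columns is tested by a bounded number of scans of the
  matrix. An independent set that is maximal among those on which a given row vanishes
  determines the row and has at most \<open>d\<close> elements, hence a reduced matrix has \<open>O(n ^ d)\<close> rows.
  Testing all sets of at most \<open>d + 1\<close> columns takes \<open>O(n ^ (d + 1))\<close> tests of
  \<open>O(n ^ d)\<close> operations each. A face is a facet iff none of its at most \<open>n\<close> extensions by
  one column is independent.\<close>

section \<open>Independence by peeling\<close>

text \<open>The time bounds leave no room for a factor \<open>n\<close> inside a test: handling one
  row must take time independent of \<open>n\<close>. The number of tested columns is therefore
  fixed when a program is built, the work on a row is straight-line code over these columns, and a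
  scan reads only their entries. Since the machine cannot multiply, row offsets and the number of
  entries arise by repeated addition. All times are stated in terms of a bound \<open>R\<close> on
  the number of rows; they become functions of \<open>n\<close> alone once \<open>R\<close> is
  replaced by 1 + n + ... + n^d. Listing and marking traverse the sets of columns in the same order,
  so the i-th mark belongs to the i-th face and no search in the list is required.\<close>

text \<open>Deleting a column that carries the only 1 of some row is the reverse of building up a
  unitriangular matrix. Columns are named by a function \<open>f\<close> of rows, so that the positions of a
  list with repeated columns can be peeled, too.\<close>

inductive peelable :: "nat \<Rightarrow> (nat \<Rightarrow> 'b \<Rightarrow> bool) \<Rightarrow> 'b set \<Rightarrow> bool" for m f where
  peelable_empty: "peelable m f {}"
| peelable_step: "r < m \<Longrightarrow> k \<in> A \<Longrightarrow> {i \<in> A. f r i} = {k} \<Longrightarrow> peelable m f (A - {k}) \<Longrightarrow> peelable m f A"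

lemma Collect_mem_eq_singleton_iff: "{i \<in> A. P i} = {k} \<longleftrightarrow> k \<in> A \<and> (\<forall>i\<in>A. P i \<longleftrightarrow> i = k)"
  by auto

lemma peelable_insert:
  assumes "peelable m f A" "r < m" "f r k" "\<forall>i\<in>A. \<not> f r i"
  shows "peelable m f (insert k A)"
proof (rule peelable_step)
  have "insert k A - {k} = A" using assms(3,4) by auto
  then show "peelable m f (insert k A - {k})" using assms(1) by simp
qed (use assms in auto)

text \<open>A row that isolates \<open>k\<close> in \<open>A\<close> isolates it in every subset
  containing \<open>k\<close>; a subset without \<open>k\<close> already lies in
  \<open>A - {k}\<close>.\<close>

lemma peelable_subset: "peelable m f A \<Longrightarrow> B \<subseteq> A \<Longrightarrow> peelable m f B"
proof (induction arbitrary: B rule: peelable.induct)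
  case peelable_empty
  then show ?case by (simp add: peelable.peelable_empty)
next
  case (peelable_step r k A)
  show ?case
  proof (cases "k \<in> B")
    case True
    have hit: "{i \<in> B. f r i} = {k}" using peelable_step.hyps(3) peelable_step.prems True
      unfolding Collect_mem_eq_singleton_iff by blast
    have "peelable m f (B - {k})" using peelable_step.IH peelable_step.prems by blast
    then show ?thesis by (rule peelable.peelable_step[where f = f, OF peelable_step.hyps(1) True hit])
  next
    case False
    then show ?thesis using peelable_step.IH peelable_step.prems by blast
  qed
qed

text \<open>Two positions naming the same column agree in every row, so neither is ever the only 1.
  Peeling positions thus detects repetitions, which the marking loop relies on.\<close>

lemma peelable_compose_imp:
  "peelable m (\<lambda>r i. f r (h i)) A \<Longrightarrow> inj_on h A \<and> peelable m f (h ` A)"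
proof (induction rule: peelable.induct)
  case peelable_empty
  then show ?case by (simp add: peelable.peelable_empty)
next
  case (peelable_step r k A)
  have A: "A = insert k (A - {k})" using peelable_step.hyps(2) by blast
  have k: "f r (h k)" and others: "\<forall>i\<in>A - {k}. \<not> f r (h i)"
    using peelable_step.hyps(3) unfolding Collect_mem_eq_singleton_iff by blast+
  then have "h k \<notin> h ` (A - {k})" by auto
  then have "inj_on h (insert k (A - {k}))" using peelable_step.IH by (simp only: inj_on_insert) auto
  moreover have "peelable m f (insert (h k) (h ` (A - {k})))"
    using peelable_step.IH peelable_step.hyps(1) k others by (intro peelable_insert) auto
  ultimately show ?case using A by (metis image_insert)
qed

lemma peelable_imp_compose:
  "peelable m f B \<Longrightarrow> B = h ` A \<Longrightarrow> inj_on h A \<Longrightarrow> peelable m (\<lambda>r i. f r (h i)) A"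
proof (induction arbitrary: A rule: peelable.induct)
  case peelable_empty
  then show ?case by (simp add: peelable.peelable_empty)
next
  case (peelable_step r k B)
  then obtain a where a: "a \<in> A" "h a = k" by blast
  have "B - {k} = h ` (A - {a})"
    using peelable_step.prems a by (auto simp: inj_on_def)
  then have rest: "peelable m (\<lambda>r i. f r (h i)) (A - {a})"
    using peelable_step.IH peelable_step.prems(2) by (blast intro: inj_on_diff)
  have "{i \<in> A. f r (h i)} = {a}"
    using peelable_step.hyps(3) peelable_step.prems a
    unfolding Collect_mem_eq_singleton_iff inj_on_def by blast
  then show ?case using rest by (rule peelable.peelable_step[where f = "\<lambda>r i. f r (h i)", OF peelable_step.hyps(1) a(1)])
qed

text \<open>The order of deletion is the order of the matrix: the row that isolates a column
  vanishes on all columns deleted later, which gives the zeros above the diagonal.\<close>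

lemma peelable_imp_unitriangular:
  "peelable m f X \<Longrightarrow> \<exists>xs ys. distinct xs \<and> set xs = X \<and> length ys = length xs \<and> set ys \<subseteq> {..<m} \<and>
     (\<forall>i<length xs. f (ys ! i) (xs ! i) \<and> (\<forall>j<length xs. i < j \<longrightarrow> \<not> f (ys ! i) (xs ! j)))"
proof (induction rule: peelable.induct)
  case peelable_empty
  show ?case by (rule exI[of _ "[]"], rule exI[of _ "[]"]) simp
next
  case (peelable_step r k A)
  then obtain xs ys where IH: "distinct xs" "set xs = A - {k}" "length ys = length xs" "set ys \<subseteq> {..<m}"
    "\<And>i j. i < length xs \<Longrightarrow> f (ys ! i) (xs ! i)"
    "\<And>i j. i < j \<Longrightarrow> j < length xs \<Longrightarrow> \<not> f (ys ! i) (xs ! j)" by auto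
  have k: "f r k" "\<And>i. i \<in> A - {k} \<Longrightarrow> \<not> f r i"
    using peelable_step.hyps(3) unfolding Collect_mem_eq_singleton_iff by blast+
  have "distinct (k # xs)" "set (k # xs) = A" "length (r # ys) = length (k # xs)"
    "set (r # ys) \<subseteq> {..<m}" using IH(1-4) peelable_step.hyps(1,2) by auto
  moreover have "\<forall>i<length (k # xs). f ((r # ys) ! i) ((k # xs) ! i) \<and>
     (\<forall>j<length (k # xs). i < j \<longrightarrow> \<not> f ((r # ys) ! i) ((k # xs) ! j))"
  proof (intro allI impI conjI)
    fix i assume "i < length (k # xs)"
    then show "f ((r # ys) ! i) ((k # xs) ! i)" using k IH by (cases i) auto
  next
    fix i j assume i: "i < length (k # xs)" and j: "j < length (k # xs)" "i < j"
    then obtain j' where j': "j = Suc j'" by (cases j) auto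
    then have "xs ! j' \<in> A - {k}" using j IH(2) by (metis Suc_less_eq length_Cons nth_mem)
    then show "\<not> f ((r # ys) ! i) ((k # xs) ! j)"
      using k IH(6) i j j' by (cases i) auto
  qed
  ultimately show ?case by blast
qed

section \<open>Submatrices up to permutation versus orders of deletion\<close>

lemma pick_bij_betw: "finite S \<Longrightarrow> bij_betw (pick S) {..<card S} S"
proof -
  assume fin: "finite S"
  have "inj_on (pick S) {..<card S}"
    by (rule linorder_inj_onI') (metis lessThan_iff nat_neq_iff pick_mono_le)
  moreover have "pick S ` {..<card S} \<subseteq> S" using pick_in_set_le by auto
  ultimately show ?thesis using fin
    by (metis bij_betw_def card_image card_lessThan card_subset_eq)
qed

text \<open>\<open>submatrix\<close> numbers the chosen indices increasingly through
  \<open>pick\<close>, while a peeling yields them in another order; \<open>p\<close> is the change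
  of numbering that \<open>nonsingular\<close> asks for.\<close>

lemma enumeration_as_permutation:
  assumes "distinct xs" "set xs = S"
  obtains p where "p permutes {..<card S}" "\<And>i. i < card S \<Longrightarrow> pick S (p i) = xs ! i"
proof -
  \<comment> \<open>Outside the index range \<open>p\<close> is the identity, as
    \<open>permutes\<close> demands.\<close>
  define p where "p i = (if i < card S then inv_into {..<card S} (pick S) (xs ! i) else i)" for i
  have b: "bij_betw (pick S) {..<card S} S" using assms(2) by (auto intro: pick_bij_betw)
  have len: "length xs = card S" using assms by (metis distinct_card)
  have p: "p i < card S \<and> pick S (p i) = xs ! i" if "i < card S" for i
  proof -
    have "xs ! i \<in> pick S ` {..<card S}" using that len assms(2) b by (auto simp: bij_betw_def)
    then show ?thesis using inv_into_into[of "xs ! i" "pick S" "{..<card S}"]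
        f_inv_into_f[of "xs ! i" "pick S" "{..<card S}"] that
      by (simp add: p_def)
  qed
  have "inj_on p {..<card S}"
    using p len assms(1) by (metis inj_onI lessThan_iff nth_eq_iff_index_eq)
  then have "p permutes {..<card S}"
    using p by (intro inj_imp_permutes) (auto simp: p_def)
  then show thesis using p that by blast
qed

lemma indep_columns_iff_peelable:
  "indep_columns M X \<longleftrightarrow> X \<subseteq> {..<dim_col M} \<and> peelable (dim_row M) (\<lambda>r c. M $$ (r, c)) X"
  (is "_ \<longleftrightarrow> _ \<and> peelable ?m ?f X")
proof (intro iffI conjI)
  assume "indep_columns M X"
  then obtain Y where X: "X \<subseteq> {..<dim_col M}" and Y: "Y \<subseteq> {..<?m}" and ns: "nonsingular (submatrix M Y X)"
    by (auto simp: indep_columns_def)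
  show "X \<subseteq> {..<dim_col M}" by (fact X)
  define k where "k = card X"
  have eqs: "{i. i < ?m \<and> i \<in> Y} = Y" "{j. j < dim_col M \<and> j \<in> X} = X" using X Y by auto
  obtain p q where p: "p permutes {..<card Y}" and q: "q permutes {..<card X}"
    and L: "lower_unitriangular (permute_mat p q (submatrix M Y X))"
    using ns by (auto simp: nonsingular_def dim_submatrix eqs)
  have kY: "card Y = k" using L by (simp add: lower_unitriangular_def permute_mat_def dim_submatrix eqs k_def)
  have less: "p i < k" "q i < k" if "i < k" for i
    using that p q kY permutes_in_image[of p] permutes_in_image[of q] by (auto simp: k_def)
  have entry: "permute_mat p q (submatrix M Y X) $$ (i, j) = M $$ (pick Y (p i), pick X (q j))"
    if "i < k" "j < k" for i j
    using that less[OF that(1)] less[OF that(2)]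
    by (simp add: permute_mat_def dim_submatrix eqs kY submatrix_index flip: k_def)
  have diag: "M $$ (pick Y (p i), pick X (q i))" if "i < k" for i
    using L that entry[OF that that] by (simp add: lower_unitriangular_def permute_mat_def dim_submatrix eqs kY flip: k_def)
  have above: "\<not> M $$ (pick Y (p i), pick X (q j))" if "i < j" "j < k" for i j
    using L that entry[of i j]
    by (simp add: lower_unitriangular_def permute_mat_def dim_submatrix eqs kY flip: k_def)
  \<comment> \<open>Suffixes of the unitriangular order are built from the last column backwards:
    row \<open>i\<close> has a 1 at column \<open>i\<close> and vanishes on the later ones.\<close>
  have "peelable ?m ?f ((\<lambda>j. pick X (q j)) ` {k - l..<k})" if "l \<le> k" for l
    using that
  proof (induction l)
    case 0
    then show ?case by (simp add: peelable_empty)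
  next
    case (Suc l)
    define i where "i = k - Suc l"
    have i: "i < k" "{k - Suc l..<k} = insert i {k - l..<k}" using Suc.prems by (auto simp: i_def)
    have "pick Y (p i) < ?m" using pick_in_set_le[of "p i" Y] less[OF i(1)] kY Y by auto
    moreover have "\<forall>c\<in>(\<lambda>j. pick X (q j)) ` {k - l..<k}. \<not> M $$ (pick Y (p i), c)"
      using above Suc.prems by (auto simp: i_def)
    ultimately show ?case unfolding i(2) image_insert
      using Suc diag[OF i(1)] by (intro peelable_insert) auto
  qed
  from this[of k] have "peelable ?m ?f ((\<lambda>j. pick X (q j)) ` {..<k})" by (simp add: atLeast0LessThan)
  moreover have "(\<lambda>j. pick X (q j)) ` {..<k} = X"
    using pick_bij_betw[of X] X permutes_image[OF q] finite_subset[OF X]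
    by (simp add: bij_betw_def k_def flip: image_image)
  ultimately show "peelable ?m ?f X" by simp
next
  assume "X \<subseteq> {..<dim_col M} \<and> peelable ?m ?f X"
  then have X: "X \<subseteq> {..<dim_col M}" and peel: "peelable ?m ?f X" by auto
  obtain xs ys where xs: "distinct xs" "set xs = X" and ys: "length ys = length xs" "set ys \<subseteq> {..<?m}"
    and diag: "\<And>i. i < length xs \<Longrightarrow> M $$ (ys ! i, xs ! i)"
    and above: "\<And>i j. i < j \<Longrightarrow> j < length xs \<Longrightarrow> \<not> M $$ (ys ! i, xs ! j)"
    using peelable_imp_unitriangular[OF peel] by auto
  define k where "k = length xs"
  define Y where "Y = set ys"
  \<comment> \<open>For \<open>i < j\<close> the rows differ at column \<open>xs ! j\<close>: the
    earlier row has 0 there, the later one its diagonal 1.\<close>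
  have "distinct ys" unfolding distinct_conv_nth
  proof (intro allI impI)
    fix i j assume "i < length ys" "j < length ys" "i \<noteq> j"
    then show "ys ! i \<noteq> ys ! j"
      using diag above ys(1) by (metis linorder_neqE_nat)
  qed
  then have cards: "card X = k" "card Y = k" using xs ys(1) distinct_card[of xs] distinct_card[of ys] by (auto simp: k_def Y_def)
  have eqs: "{i. i < ?m \<and> i \<in> Y} = Y" "{j. j < dim_col M \<and> j \<in> X} = X" using X ys(2) by (auto simp: Y_def)
  obtain p where p: "p permutes {..<k}" "\<And>i. i < k \<Longrightarrow> pick Y (p i) = ys ! i"
    using enumeration_as_permutation[OF \<open>distinct ys\<close>, of Y] cards by (metis Y_def)
  obtain q where q: "q permutes {..<k}" "\<And>i. i < k \<Longrightarrow> pick X (q i) = xs ! i"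
    using enumeration_as_permutation[OF xs] cards by metis
  have less: "p i < k" "q i < k" if "i < k" for i
    using that p(1) q(1) permutes_in_image[of p] permutes_in_image[of q] by auto
  have entry: "permute_mat p q (submatrix M Y X) $$ (i, j) = M $$ (ys ! i, xs ! j)"
    if "i < k" "j < k" for i j
    using that less[OF that(1)] less[OF that(2)] p(2) q(2)
    by (simp add: permute_mat_def dim_submatrix eqs cards submatrix_index)
  have "lower_unitriangular (permute_mat p q (submatrix M Y X))"
    unfolding lower_unitriangular_def
    using entry diag above
    by (auto simp: permute_mat_def[of p q "submatrix M Y X"] dim_submatrix eqs cards k_def)
  then have "nonsingular (submatrix M Y X)"
    using p(1) q(1) by (auto simp: nonsingular_def dim_submatrix eqs cards)
  then show "indep_columns M X" using X ys(2) by (auto simp: indep_columns_def Y_def)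
qed

text \<open>A set that is maximal among the peelable sets of zeros of a row determines the zeros of that
  row, and it has at most \<open>d\<close> elements since any 1 of the row extends it.\<close>

lemma reduced_dim_row_le:
  assumes red: "reduced M" and dim: "\<And>X. indep_columns M X \<Longrightarrow> card X \<le> Suc d"
  shows "dim_row M \<le> (\<Sum>i\<le>d. dim_col M ^ i)"
proof -
  define Z where "Z r = {c. c < dim_col M \<and> \<not> M $$ (r, c)}" for r
  define peel where "peel = peelable (dim_row M) (\<lambda>r c. M $$ (r, c))"
  \<comment> \<open>Maximality is by cardinality, so that a bounded measure gives existence.\<close>
  define maxi where "maxi r X \<longleftrightarrow> X \<subseteq> Z r \<and> peel X \<and> (\<forall>X'. X' \<subseteq> Z r \<and> peel X' \<longrightarrow> card X' \<le> card X)" for r X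
  have finZ: "finite (Z r)" for r by (simp add: Z_def)
  have ex: "\<exists>X. maxi r X" for r
  proof -
    have "{} \<subseteq> Z r \<and> peel {}" by (simp add: peel_def peelable_empty)
    moreover have "\<forall>X. X \<subseteq> Z r \<and> peel X \<longrightarrow> card X < Suc (card (Z r))"
      using finZ by (auto intro: card_mono simp: less_Suc_eq_le)
    ultimately show ?thesis unfolding maxi_def
      using ex_has_greatest_nat[of "\<lambda>X. X \<subseteq> Z r \<and> peel X" "{}" card "Suc (card (Z r))"] by auto
  qed
  define B where "B r = (SOME X. maxi r X)" for r
  have B: "maxi r (B r)" for r unfolding B_def using ex by (rule someI_ex)
  have fin: "finite (B r)" for r using B[of r] finZ[of r] by (auto simp: maxi_def intro: finite_subset)
  \<comment> \<open>\<open>B r\<close> consists of zeros of row \<open>r\<close>, so this row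
    isolates any of its 1s against \<open>B r\<close>.\<close>
  have grow: "peel (insert c (B r))" "c \<notin> B r" if "r < dim_row M" "M $$ (r, c)" for r c
    using that B[of r] by (auto simp: maxi_def peel_def Z_def intro!: peelable_insert)
  have small: "card (B r) \<le> d" if r: "r < dim_row M" for r
  proof -
    have "\<exists>c<dim_col M. M $$ (r, c)"
    proof (rule ccontr)
      assume "\<not> ?thesis"
      then have "row M r = vec (dim_col M) (\<lambda>_. False)" using r by (intro eq_vecI) auto
      then show False using red r by (auto simp: reduced_def)
    qed
    then obtain c where c: "c < dim_col M" "M $$ (r, c)" by blast
    have "insert c (B r) \<subseteq> {..<dim_col M}" using c B by (auto simp: maxi_def Z_def)
    then have "indep_columns M (insert c (B r))"
      using grow[OF r c(2)] by (simp add: indep_columns_iff_peelable peel_def)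
    then have "card (insert c (B r)) \<le> Suc d" by (rule dim)
    then show ?thesis using grow(2)[OF r c(2)] fin[of r] by simp
  qed
  \<comment> \<open>A column with 1 in row \<open>r\<close> and 0 in row \<open>r'\<close> could be
    added to the common set without leaving the zeros of \<open>r'\<close>, contradicting maximality
    there.\<close>
  have zeros: "Z r' \<subseteq> Z r" if eq: "B r = B r'" and r: "r < dim_row M" for r r'
  proof
    fix c assume c: "c \<in> Z r'"
    show "c \<in> Z r"
    proof (rule ccontr)
      assume "c \<notin> Z r"
      then have "M $$ (r, c)" using c by (auto simp: Z_def)
      then have "peel (insert c (B r'))" "c \<notin> B r'" using grow[OF r, of c] eq by auto
      moreover have "insert c (B r') \<subseteq> Z r'" using B[of r'] c by (auto simp: maxi_def)
      ultimately have "card (insert c (B r')) \<le> card (B r')" using B[of r'] by (simp add: maxi_def)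
      then show False using \<open>c \<notin> B r'\<close> fin[of r'] by simp
    qed
  qed
  have "inj_on B {..<dim_row M}"
  proof (rule inj_onI)
    fix r r' assume r: "r \<in> {..<dim_row M}" "r' \<in> {..<dim_row M}" and "B r = B r'"
    then have "Z r = Z r'" using zeros[of r r'] zeros[of r' r] by auto
    then have "row M r = row M r'" using r by (intro eq_vecI) (auto simp: Z_def)
    then show "r = r'" using red r by (auto simp: reduced_def distinct_conv_nth)
  qed
  \<comment> \<open>Counting sets through lists overcounts, but the exponent \<open>d\<close> is
    kept.\<close>
  moreover have "B ` {..<dim_row M} \<subseteq> set ` {xs. set xs \<subseteq> {..<dim_col M} \<and> length xs \<le> d}"
  proof
    fix X assume "X \<in> B ` {..<dim_row M}"
    then obtain r where "X = B r" "r < dim_row M" by auto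
    then have X: "X \<subseteq> {..<dim_col M}" "finite X" "card X \<le> d"
      using small[of r] fin[of r] B[of r] by (auto simp: maxi_def Z_def)
    then have "sorted_list_of_set X \<in> {xs. set xs \<subseteq> {..<dim_col M} \<and> length xs \<le> d}" by simp
    then have "set (sorted_list_of_set X) \<in> set ` {xs. set xs \<subseteq> {..<dim_col M} \<and> length xs \<le> d}"
      by (rule imageI)
    then show "X \<in> set ` {xs. set xs \<subseteq> {..<dim_col M} \<and> length xs \<le> d}" using X(2) by simp
  qed
  ultimately have "card {..<dim_row M} \<le> card (set ` {xs. set xs \<subseteq> {..<dim_col M} \<and> length xs \<le> d})"
    by (intro card_inj_on_le[of B] finite_imageI finite_lists_length_le) auto
  also have "\<dots> \<le> card {xs. set xs \<subseteq> {..<dim_col M} \<and> length xs \<le> d}"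
    by (intro card_image_le finite_lists_length_le) simp
  also have "\<dots> = (\<Sum>i\<le>d. dim_col M ^ i)" by (simp add: card_lists_length_le)
  finally show ?thesis by simp
qed

section \<open>Greedy peeling\<close>

definition peel_row :: "(nat \<Rightarrow> 'b \<Rightarrow> bool) \<Rightarrow> nat \<Rightarrow> 'b set \<Rightarrow> 'b set" where
  "peel_row f r A = (if card {i \<in> A. f r i} = 1 then A - {i \<in> A. f r i} else A)"

primrec peel_rows :: "(nat \<Rightarrow> 'b \<Rightarrow> bool) \<Rightarrow> nat \<Rightarrow> 'b set \<Rightarrow> 'b set" where
  "peel_rows f 0 A = A"
| "peel_rows f (Suc r) A = peel_row f r (peel_rows f r A)"

lemma peel_row_subset: "peel_row f r A \<subseteq> A"
  by (auto simp: peel_row_def)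

lemma peel_rows_subset: "peel_rows f r A \<subseteq> A"
  by (induction r) (use peel_row_subset in fastforce)+

text \<open>A deletion never spoils a peeling: the smaller set inherits peelability, and the
  deletion itself is a legal first step for the larger one.\<close>

lemma peelable_peel_row:
  assumes "r < m"
  shows "peelable m f (peel_row f r A) \<longleftrightarrow> peelable m f A"
proof (cases "card {i \<in> A. f r i} = 1")
  case True
  then obtain k where k: "{i \<in> A. f r i} = {k}" by (auto simp: card_1_singleton_iff)
  then have "peelable m f A" if "peelable m f (A - {k})"
    using assms that by (intro peelable_step[of r m k A]) auto
  then show ?thesis using True k peelable_subset[of m f A "A - {k}"] by (auto simp: peel_row_def)
qed (simp add: peel_row_def)

lemma peelable_peel_rows: "r \<le> m \<Longrightarrow> peelable m f (peel_rows f r A) \<longleftrightarrow> peelable m f A"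
  by (induction r) (auto simp: peelable_peel_row)

text \<open>Sets only shrink during a scan, so an unchanged result means that no row acted at all;
  but the first step of a peeling of \<open>A\<close> supplies a row that acts on
  \<open>A\<close>.\<close>

lemma peel_rows_decreases:
  assumes "peelable m f A" "A \<noteq> {}"
  shows "peel_rows f m A \<noteq> A"
proof
  assume fixed: "peel_rows f m A = A"
  have "m = r + l \<Longrightarrow> peel_rows f r A = A" for r l
  proof (induction l arbitrary: r)
    case 0
    then show ?case using fixed by simp
  next
    case (Suc l)
    then have "peel_row f r (peel_rows f r A) = A" using Suc.IH[of "Suc r"] by simp
    then show ?case using peel_row_subset[of f r "peel_rows f r A"] peel_rows_subset[of f r A] by auto
  qed
  then have same: "peel_rows f r A = A" if "r \<le> m" for r using that by (metis le_add_diff_inverse)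
  obtain r k where r: "r < m" "k \<in> A" "{i \<in> A. f r i} = {k}"
    by (rule peelable.cases[OF assms(1)]) (use assms(2) in \<open>blast+\<close>)
  then have "peel_rows f (Suc r) A \<noteq> A" using same[of r] by (auto simp: peel_row_def)
  then show False using same[of "Suc r"] r(1) by simp
qed

lemma peel_rows_funpow_subset: "(peel_rows f m ^^ l) A \<subseteq> A"
  by (induction l) (use peel_rows_subset in fastforce)+

text \<open>Scans preserve peelability in both directions, and each scan of a nonempty peelable set
  removes a column. After \<open>card A\<close> scans only emptiness remains to be checked.\<close>

lemma peelable_iff_greedy:
  assumes "finite A"
  shows "peelable m f A \<longleftrightarrow> (peel_rows f m ^^ card A) A = {}"
proof
  have iff: "peelable m f ((peel_rows f m ^^ l) A) \<longleftrightarrow> peelable m f A" for l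
    by (induction l) (auto simp: peelable_peel_rows)
  {
    assume peel: "peelable m f A"
    have "card ((peel_rows f m ^^ l) A) \<le> card A - l" for l
    proof (induction l)
      case (Suc l)
      let ?A = "(peel_rows f m ^^ l) A"
      have fin: "finite ?A" using assms peel_rows_funpow_subset finite_subset by metis
      show ?case
      proof (cases "?A = {}")
        case True
        then show ?thesis using peel_rows_subset[of f m "{}"] by simp
      next
        case False
        then have "peel_rows f m ?A \<subset> ?A"
          using peel_rows_decreases[of m f ?A] peel_rows_subset[of f m ?A] iff[of l] peel
          by (simp add: psubset_eq)
        then have "card (peel_rows f m ?A) < card ?A" using fin by (intro psubset_card_mono)
        then show ?thesis using Suc by simp
      qed
    qed simp
    from this[of "card A"] show "(peel_rows f m ^^ card A) A = {}"
      using finite_subset[OF peel_rows_funpow_subset assms] card_0_eq by force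
  }
  show "peelable m f A" if "(peel_rows f m ^^ card A) A = {}"
    using iff[of "card A"] that by (simp add: peelable_empty)
qed

section \<open>Enumerating increasing lists\<close>

definition next_column :: "nat list \<Rightarrow> nat" where
  "next_column xs = (if xs = [] then 0 else Suc (last xs))"

text \<open>Preorder of the tree of lists that prolong \<open>xs\<close> increasingly by at most
  \<open>r\<close> columns below \<open>n\<close>; the recursion mirrors the nested loops of
  \<open>visit\<close>.\<close>

primrec extensions :: "nat \<Rightarrow> nat \<Rightarrow> nat list \<Rightarrow> nat list list" where
  "extensions n 0 xs = [xs]"
| "extensions n (Suc r) xs = xs # concat (map (\<lambda>x. extensions n r (xs @ [x])) [next_column xs..<n])"

lemma set_extensions:
  "zs \<in> set (extensions n r xs) \<longleftrightarrow>
     (\<exists>ys. zs = xs @ ys \<and> length ys \<le> r \<and> sorted_wrt (<) ys \<and> set ys \<subseteq> {next_column xs..<n})"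
proof (induction r arbitrary: xs)
  case (Suc r)
  show ?case (is "?L \<longleftrightarrow> ?R")
  proof
    assume ?L
    then consider "zs = xs" | x where "x \<in> {next_column xs..<n}" "zs \<in> set (extensions n r (xs @ [x]))"
      by auto
    then show ?R
    proof cases
      case 2
      then obtain ys where ys: "zs = xs @ x # ys" "length ys \<le> r" "sorted_wrt (<) ys" "set ys \<subseteq> {Suc x..<n}"
        using Suc.IH by (auto simp: next_column_def)
      then show ?R using 2(1) by (intro exI[of _ "x # ys"]) fastforce
    qed simp
  next
    assume ?R
    then obtain ys where ys: "zs = xs @ ys" "length ys \<le> Suc r" "sorted_wrt (<) ys" "set ys \<subseteq> {next_column xs..<n}"
      by blast
    show ?L
    proof (cases ys)
      case Nil
      then show ?thesis using ys by simp
    next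
      case (Cons x ys')
      have "zs \<in> set (extensions n r (xs @ [x]))"
        unfolding Suc.IH using ys Cons by (intro exI[of _ ys']) (auto simp: next_column_def Suc_le_eq)
      then show ?thesis using ys Cons by auto
    qed
  qed
qed auto

lemma distinct_extensions: "distinct (extensions n r xs)"
proof (induction r arbitrary: xs)
  case (Suc r)
  have "distinct (concat (map (\<lambda>x. extensions n r (xs @ [x])) ks))" if "distinct ks" for ks
    using that
  proof (induction ks)
    case (Cons k ks)
    have "set (extensions n r (xs @ [k])) \<inter> set (extensions n r (xs @ [x])) = {}" if "x \<noteq> k" for x
      using that by (auto simp: set_extensions)
    then show ?case using Cons Suc.IH by (fastforce simp del: Int_iff)
  qed simp
  moreover have "xs \<notin> set (extensions n r (xs @ [x]))" for x by (auto simp: set_extensions)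
  ultimately show ?case by auto
qed simp

lemma distinct_map_set_sorted:
  assumes "distinct L" "\<And>xs. xs \<in> set L \<Longrightarrow> sorted_wrt (<) (xs :: nat list)"
  shows "distinct (map set L)"
  unfolding distinct_map using assms
  by (auto intro!: inj_onI simp: strict_sorted_equal)

section \<open>Reasoning about programs\<close>

text \<open>Total correctness with a time bound. As \<open>run\<close> is deterministic, the halting
  run asserted here is the only one.\<close>

definition hoare :: "(store \<Rightarrow> bool) \<Rightarrow> prog \<Rightarrow> nat \<Rightarrow> (store \<Rightarrow> bool) \<Rightarrow> bool" where
  "hoare P c t Q \<longleftrightarrow> (\<forall>s. P s \<longrightarrow> (\<exists>u s'. run c s u s' \<and> u \<le> t \<and> Q s'))"

lemma hoare_conseq:
  assumes "hoare P c t Q" "\<And>s. P' s \<Longrightarrow> P s" "\<And>s. Q s \<Longrightarrow> Q' s" "t \<le> t'"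
  shows "hoare P' c t' Q'"
  using assms unfolding hoare_def by (meson order_trans)

lemma hoare_Seq: "hoare P c t Q \<Longrightarrow> hoare Q c' t' R \<Longrightarrow> hoare P (Seq c c') (t + t') R"
  unfolding hoare_def by (meson add_mono run_Seq)

text \<open>The times of both branches are added rather than maximised; this keeps bounds free of
  case distinctions.\<close>

lemma hoare_Cond:
  assumes "hoare (\<lambda>s. P s \<and> eval_expr e s \<noteq> 0) c t Q" "hoare (\<lambda>s. P s \<and> eval_expr e s = 0) c' t' Q"
  shows "hoare P (Cond e c c') (1 + cost_expr e + t + t') Q"
  unfolding hoare_def
proof (intro allI impI)
  fix s assume P: "P s"
  show "\<exists>u s'. run (Cond e c c') s u s' \<and> u \<le> 1 + cost_expr e + t + t' \<and> Q s'"
  proof (cases "eval_expr e s = 0")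
    case True
    then obtain u s' where "run c' s u s'" "u \<le> t'" "Q s'"
      using P assms(2) unfolding hoare_def by blast
    with run_Cond_false[OF True this(1), of c] show ?thesis by fastforce
  next
    case False
    then obtain u s' where "run c s u s'" "u \<le> t" "Q s'"
      using P assms(1) unfolding hoare_def by blast
    with run_Cond_true[OF False this(1), of c'] show ?thesis by fastforce
  qed
qed

text \<open>The invariant is indexed by the number of completed rounds, which is exactly
  \<open>k\<close> in the end. The separate bound \<open>K\<close> frees the time from the
  particular matrix or list that determines \<open>k\<close>.\<close>

lemma hoare_While:
  assumes body: "\<And>i. i < k \<Longrightarrow> hoare (I i) c t (I (Suc i))"
    and guard: "\<And>i s. i \<le> k \<Longrightarrow> I i s \<Longrightarrow> eval_expr e s \<noteq> 0 \<longleftrightarrow> i < k"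
    and "k \<le> K"
  shows "hoare (I 0) (While e c) (K * (1 + cost_expr e + t) + (1 + cost_expr e)) (I k)"
proof -
  have "hoare (I i) (While e c) (l * (1 + cost_expr e + t) + (1 + cost_expr e)) (I k)"
    if "k = i + l" for i l
    using that
  proof (induction l arbitrary: i)
    case 0
    then show ?case using guard[of k] run_While_false unfolding hoare_def by fastforce
  next
    case (Suc l)
    show ?case unfolding hoare_def
    proof (intro allI impI)
      fix s assume I: "I i s"
      obtain u s' where 1: "run c s u s'" "u \<le> t" "I (Suc i) s'"
        using body[of i] Suc.prems I unfolding hoare_def by auto
      obtain v s'' where 2: "run (While e c) s' v s''" "v \<le> l * (1 + cost_expr e + t) + (1 + cost_expr e)" "I k s''"
        using Suc.IH[of "Suc i"] Suc.prems 1(3) unfolding hoare_def by auto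
      have "eval_expr e s \<noteq> 0" using guard[of i s] I Suc.prems by simp
      from run_While_true[OF this 1(1) 2(1)] 1(2) 2(2,3)
      show "\<exists>u s'. run (While e c) s u s' \<and> u \<le> Suc l * (1 + cost_expr e + t) + (1 + cost_expr e) \<and> I k s'"
        by fastforce
    qed
  qed
  from this[of 0 k] show ?thesis
    by (rule hoare_conseq) (simp, assumption, assumption,
      intro add_mono mult_le_mono1 order.refl \<open>k \<le> K\<close>)
qed

section \<open>Straight-line programs\<close>

primrec loop_free :: "prog \<Rightarrow> bool" where
  "loop_free Skip = True"
| "loop_free (Write a i e) = True"
| "loop_free (Seq c c') = (loop_free c \<and> loop_free c')"
| "loop_free (Cond e c c') = (loop_free c \<and> loop_free c')"
| "loop_free (While e c) = False"

primrec exec :: "prog \<Rightarrow> store \<Rightarrow> store" where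
  "exec Skip s = s"
| "exec (Write a i e) s = s(a := (s a)(eval_expr i s := eval_expr e s))"
| "exec (Seq c c') s = exec c' (exec c s)"
| "exec (Cond e c c') s = (if eval_expr e s \<noteq> 0 then exec c s else exec c' s)"
| "exec (While e c) s = s"

primrec cost_prog :: "prog \<Rightarrow> nat" where
  "cost_prog Skip = 1"
| "cost_prog (Write a i e) = 1 + cost_expr i + cost_expr e"
| "cost_prog (Seq c c') = cost_prog c + cost_prog c'"
| "cost_prog (Cond e c c') = 1 + cost_expr e + cost_prog c + cost_prog c'"
| "cost_prog (While e c) = 0"

text \<open>Reduces correctness of straight-line code to simplification of \<open>exec\<close>, with
  the size of the program as its time.\<close>

lemma hoare_loop_free:
  assumes "loop_free c" "\<And>s. P s \<Longrightarrow> Q (exec c s)"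
  shows "hoare P c (cost_prog c) Q"
proof -
  have "loop_free c \<Longrightarrow> \<exists>u. run c s u (exec c s) \<and> u \<le> cost_prog c" for c s
  proof (induction c arbitrary: s)
    case Skip
    show ?case using run_Skip by auto
  next
    case (Write a i e)
    show ?case unfolding exec.simps cost_prog.simps using run_Write by blast
  next
    case (Seq c c')
    then obtain u u' where "run c s u (exec c s)" "u \<le> cost_prog c"
      "run c' (exec c s) u' (exec c' (exec c s))" "u' \<le> cost_prog c'"
      by fastforce
    then show ?case using run_Seq by (fastforce intro: add_mono)
  next
    case (Cond e c c')
    then obtain u u' where u: "run c s u (exec c s)" "u \<le> cost_prog c"
      "run c' s u' (exec c' s)" "u' \<le> cost_prog c'"
      by fastforce
    show ?case
    proof (cases "eval_expr e s = 0")
      case True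
      from run_Cond_false[OF True u(3), of c] u(4) True show ?thesis by fastforce
    next
      case False
      from run_Cond_true[OF False u(1), of c'] u(2) False show ?thesis by fastforce
    qed
  qed simp
  then show ?thesis using assms unfolding hoare_def by blast
qed

abbreviation var :: "arr \<Rightarrow> expr" where "var a \<equiv> Read a (Const 0)"
abbreviation assign :: "arr \<Rightarrow> expr \<Rightarrow> prog" where "assign a e \<equiv> Write a (Const 0) e"

section \<open>Testing independence\<close>

abbreviation "stack \<equiv> Work 0"
abbreviation "live \<equiv> Work 1"
abbreviation "pos \<equiv> Work 2"
abbreviation "left \<equiv> Work 3"
abbreviation "area \<equiv> Work 4"

text \<open>The columns on the stack are copied to the array \<open>live\<close>. A deleted column is replaced there by
  the number of entries of the matrix, so that it refers to a cell holding 0 from every row.\<close>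

primrec load :: "nat \<Rightarrow> prog" where
  "load 0 = Skip"
| "load (Suc i) = Seq (load i) (Write live (Const i) (Read stack (Const i)))"

text \<open>\<open>pos\<close> holds the offset of the current row, so one addition reaches an
  entry; the cost depends on the number of columns only.\<close>

primrec column_sum :: "nat \<Rightarrow> expr" where
  "column_sum 0 = Const 0"
| "column_sum (Suc i) = Add (column_sum i) (Read Entries (Add (var pos) (Read live (Const i))))"

primrec delete :: "nat \<Rightarrow> prog" where
  "delete 0 = Skip"
| "delete (Suc i) = Seq (delete i)
     (Cond (Read Entries (Add (var pos) (Read live (Const i)))) (Write live (Const i) (var area)) Skip)"

text \<open>In truncated arithmetic, e - 2(e - 1) is 0 at e = 0, is 1 at e = 1, and is cut off to 0
  for every e \<ge> 2.\<close>

definition is_one :: "expr \<Rightarrow> expr" where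
  "is_one e = Sub e (Add (Sub e (Const 1)) (Sub e (Const 1)))"

definition scan_row :: "nat \<Rightarrow> prog" where
  "scan_row j = Seq
     (Cond (is_one (column_sum j)) (Seq (delete j) (assign left (Sub (var left) (Const 1)))) Skip)
     (assign pos (Add (var pos) (var Num_Cols)))"

definition scan_guard :: expr where
  "scan_guard = Sub (var area) (var pos)"

definition scan :: "nat \<Rightarrow> prog" where
  "scan j = Seq (assign pos (Const 0)) (While scan_guard (scan_row j))"

primrec scans :: "nat \<Rightarrow> nat \<Rightarrow> prog" where
  "scans j 0 = Skip"
| "scans j (Suc l) = Seq (scan j) (scans j l)"

definition setup_test :: "nat \<Rightarrow> prog" where
  "setup_test j = Seq (load j) (assign left (Const j))"

definition test :: "nat \<Rightarrow> prog" where
  "test j = Seq (setup_test j) (scans j j)"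

text \<open>Linear in the row bound \<open>R\<close>; the other terms depend on \<open>j\<close>
  alone and are left as unevaluated costs.\<close>

definition scan_time :: "nat \<Rightarrow> nat \<Rightarrow> nat" where
  "scan_time j R = cost_prog (assign pos (Const 0)) +
     (R * (1 + cost_expr scan_guard + cost_prog (scan_row j)) + (1 + cost_expr scan_guard))"

definition test_time :: "nat \<Rightarrow> nat \<Rightarrow> nat" where
  "test_time j R = cost_prog (setup_test j) + (j * scan_time j R + 1)"

definition holds_matrix :: "bool mat \<Rightarrow> store \<Rightarrow> bool" where
  "holds_matrix M s \<longleftrightarrow> s Num_Rows 0 = dim_row M \<and> s Num_Cols 0 = dim_col M \<and>
     s Entries = input_store M Entries \<and> s area 0 = dim_row M * dim_col M"

definition holds_stack :: "nat list \<Rightarrow> store \<Rightarrow> bool" where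
  "holds_stack xs s \<longleftrightarrow> (\<forall>i<length xs. s stack i = xs ! i)"

definition agree_outside :: "arr set \<Rightarrow> store \<Rightarrow> store \<Rightarrow> bool" where
  "agree_outside B s s' \<longleftrightarrow> (\<forall>a. a \<notin> B \<longrightarrow> s' a = s a)"

text \<open>\<open>A\<close> is a set of positions in \<open>xs\<close>, not of columns, so that
  repetitions remain visible. Its cardinality is kept in \<open>left\<close>, which makes emptiness
  a single read.\<close>

definition holds_live :: "bool mat \<Rightarrow> nat list \<Rightarrow> store \<Rightarrow> nat set \<Rightarrow> store \<Rightarrow> bool" where
  "holds_live M xs s\<^sub>0 A s \<longleftrightarrow> agree_outside {live, pos, left} s\<^sub>0 s \<and> s left 0 = card A \<and>
     (\<forall>i<length xs. s live i = (if i \<in> A then xs ! i else dim_row M * dim_col M))"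

lemma loop_free_load [simp]: "loop_free (load i)" by (induction i) auto
lemma loop_free_delete [simp]: "loop_free (delete i)" by (induction i) auto

lemma exec_load: "exec (load j) s = s(live := \<lambda>k. if k < j then s stack k else s live k)"
  by (induction j) (auto simp: fun_eq_iff less_Suc_eq)

lemma exec_delete:
  "exec (delete j) s = s(live := \<lambda>k. if k < j \<and> s Entries (s pos 0 + s live k) \<noteq> 0 then s area 0 else s live k)"
  by (induction j) (auto simp: fun_eq_iff less_Suc_eq)

lemma eval_is_one: "eval_expr (is_one e) s \<noteq> 0 \<longleftrightarrow> eval_expr e s = 1"
  by (auto simp: is_one_def)

lemma input_store_Entries:
  assumes "r < dim_row M" "c < dim_col M"
  shows "input_store M Entries (r * dim_col M + c) = of_bool (M $$ (r, c))"
proof -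
  have "r * dim_col M + c < Suc r * dim_col M" using assms by simp
  also have "\<dots> \<le> dim_row M * dim_col M" using assms by (intro mult_le_mono1) simp
  finally show ?thesis using assms by (simp add: input_store_def)
qed

lemma input_store_Entries_beyond: "input_store M Entries (p + dim_row M * dim_col M) = 0"
  by (simp add: input_store_def)

context
  fixes M :: "bool mat" and xs :: "nat list" and s\<^sub>0 :: store and f :: "nat \<Rightarrow> nat \<Rightarrow> bool" and R :: nat
  assumes matrix: "holds_matrix M s\<^sub>0" and cols: "set xs \<subseteq> {..<dim_col M}" and rows: "dim_row M \<le> R"
  defines "f \<equiv> \<lambda>r i. M $$ (r, xs ! i)"
begin

lemma live_entry:
  assumes "holds_live M xs s\<^sub>0 A s" "s pos 0 = r * dim_col M" "r < dim_row M" "i < length xs"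
  shows "s Entries (s pos 0 + s live i) = of_bool (i \<in> A \<and> f r i)"
proof -
  have "s Entries = input_store M Entries" "s live i = (if i \<in> A then xs ! i else dim_row M * dim_col M)"
    using assms matrix by (auto simp: holds_live_def holds_matrix_def agree_outside_def)
  moreover have "xs ! i < dim_col M" using cols assms(4) nth_mem by blast
  ultimately show ?thesis
    using assms input_store_Entries input_store_Entries_beyond by (auto simp: f_def)
qed

lemma eval_column_sum:
  assumes "holds_live M xs s\<^sub>0 A s" "s pos 0 = r * dim_col M" "r < dim_row M" "j \<le> length xs"
  shows "eval_expr (column_sum j) s = card {i \<in> A. i < j \<and> f r i}"
  using assms(4)
proof (induction j)
  case (Suc j)
  have "{i \<in> A. i < Suc j \<and> f r i} =
      (if j \<in> A \<and> f r j then insert j {i \<in> A. i < j \<and> f r i} else {i \<in> A. i < j \<and> f r i})"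
    by (auto simp: less_Suc_eq)
  moreover have "finite {i \<in> A. i < j \<and> f r i}" by (rule finite_subset[of _ "{..<j}"]) auto
  ultimately show ?case using Suc live_entry[OF assms(1-3), of j] by simp
qed simp

lemma scan_row_correct:
  assumes A: "A \<subseteq> {..<length xs}" and r: "r < dim_row M"
  shows "hoare (\<lambda>s. holds_live M xs s\<^sub>0 A s \<and> s pos 0 = r * dim_col M)
    (scan_row (length xs)) (cost_prog (scan_row (length xs)))
    (\<lambda>s. holds_live M xs s\<^sub>0 (peel_row f r A) s \<and> s pos 0 = Suc r * dim_col M)"
proof (rule hoare_loop_free, goal_cases)
  case (2 s)
  then have live: "holds_live M xs s\<^sub>0 A s" and pos: "s pos 0 = r * dim_col M" by auto
  let ?hits = "{i \<in> A. f r i}"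
  have "{i \<in> A. i < length xs \<and> f r i} = ?hits" using A by auto
  then have sum: "eval_expr (column_sum (length xs)) s = card ?hits"
    using eval_column_sum[OF live pos r order.refl] by simp
  have n: "s Num_Cols 0 = dim_col M" "s area 0 = dim_row M * dim_col M"
    using live matrix by (auto simp: holds_live_def holds_matrix_def agree_outside_def)
  show ?case
  proof (cases "card ?hits = 1")
    case True
    have "finite ?hits" using A by (auto intro: finite_subset)
    then have "card (A - ?hits) = card A - 1" using True by (simp add: card_Diff_subset)
    \<comment> \<open>\<open>delete\<close> clears every hit position; as there is just one,
      lowering \<open>left\<close> by 1 keeps the count.\<close>
    moreover have "(if s Entries (s pos 0 + s live i) \<noteq> 0 then s area 0 else s live i) =
        (if i \<in> A - ?hits then xs ! i else dim_row M * dim_col M)" if "i < length xs" for i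
      using live_entry[OF live pos r that] live n that by (auto simp: holds_live_def)
    ultimately show ?thesis
      using True sum live pos n eval_is_one[of "column_sum (length xs)" s]
      by (simp add: scan_row_def exec_delete peel_row_def holds_live_def agree_outside_def)
  next
    case False
    then show ?thesis using sum live pos n eval_is_one[of "column_sum (length xs)" s]
      by (simp add: scan_row_def peel_row_def holds_live_def agree_outside_def)
  qed
qed (simp add: scan_row_def)

lemma scan_correct:
  assumes A: "A \<subseteq> {..<length xs}" and n: "0 < dim_col M"
  shows "hoare (holds_live M xs s\<^sub>0 A) (scan (length xs)) (scan_time (length xs) R)
    (holds_live M xs s\<^sub>0 (peel_rows f (dim_row M) A))"
  unfolding scan_def scan_time_def
proof (rule hoare_Seq)
  let ?I = "\<lambda>r s. holds_live M xs s\<^sub>0 (peel_rows f r A) s \<and> s pos 0 = r * dim_col M"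
  show "hoare (holds_live M xs s\<^sub>0 A) (assign pos (Const 0))
      (cost_prog (assign pos (Const 0))) (?I 0)"
    by (rule hoare_loop_free) (auto simp: holds_live_def agree_outside_def)
  show "hoare (?I 0) (While scan_guard (scan_row (length xs)))
     (R * (1 + cost_expr scan_guard + cost_prog (scan_row (length xs))) + (1 + cost_expr scan_guard))
     (holds_live M xs s\<^sub>0 (peel_rows f (dim_row M) A))"
  proof (rule hoare_conseq[OF hoare_While[where I = ?I and k = "dim_row M"]])
    fix r assume "r < dim_row M"
    then show "hoare (?I r) (scan_row (length xs)) (cost_prog (scan_row (length xs))) (?I (Suc r))"
      using scan_row_correct[of "peel_rows f r A" r] A peel_rows_subset[of f r A] by simp
  next
    fix r s assume "r \<le> dim_row M" "?I r s"
    moreover from this have "s area 0 = dim_row M * dim_col M"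
      using matrix by (auto simp: holds_live_def holds_matrix_def agree_outside_def)
    \<comment> \<open>With at least one column, comparing offsets amounts to comparing row
      numbers.\<close>
    ultimately show "eval_expr scan_guard s \<noteq> 0 \<longleftrightarrow> r < dim_row M"
      using n by (auto simp: scan_guard_def)
  qed (use rows in auto)
qed

lemma scans_correct:
  assumes A: "A \<subseteq> {..<length xs}" and n: "0 < dim_col M"
  shows "hoare (holds_live M xs s\<^sub>0 A) (scans (length xs) l) (l * scan_time (length xs) R + 1)
    (holds_live M xs s\<^sub>0 ((peel_rows f (dim_row M) ^^ l) A))"
  using A
proof (induction l arbitrary: A)
  case 0
  then show ?case using hoare_loop_free[of Skip] by simp
next
  case (Suc l)
  have "hoare (holds_live M xs s\<^sub>0 (peel_rows f (dim_row M) A)) (scans (length xs) l) (l * scan_time (length xs) R + 1)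
    (holds_live M xs s\<^sub>0 ((peel_rows f (dim_row M) ^^ Suc l) A))"
    using Suc.IH[of "peel_rows f (dim_row M) A"] Suc.prems peel_rows_subset[of f "dim_row M" A]
    by (simp add: funpow_swap1)
  from hoare_Seq[OF scan_correct[OF Suc.prems n] this] show ?case by (simp add: add.assoc)
qed

lemma test_correct_peelable:
  assumes stack: "holds_stack xs s\<^sub>0" and n: "0 < dim_col M"
  shows "hoare (\<lambda>s. s = s\<^sub>0) (test (length xs)) (test_time (length xs) R)
    (\<lambda>s. agree_outside {live, pos, left} s\<^sub>0 s \<and>
      (s left 0 = 0 \<longleftrightarrow> peelable (dim_row M) f {..<length xs}))"
  unfolding test_def test_time_def
proof (rule hoare_Seq)
  show "hoare (\<lambda>s. s = s\<^sub>0) (setup_test (length xs)) (cost_prog (setup_test (length xs)))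
      (holds_live M xs s\<^sub>0 {..<length xs})"
    using stack by (intro hoare_loop_free)
      (auto simp: setup_test_def exec_load holds_live_def holds_stack_def agree_outside_def)
  define A where "A = (peel_rows f (dim_row M) ^^ length xs) {..<length xs}"
  have "peelable (dim_row M) f {..<length xs} \<longleftrightarrow> A = {}"
    using peelable_iff_greedy[of "{..<length xs}"] by (simp add: A_def)
  moreover have "finite A" unfolding A_def using peel_rows_funpow_subset by (rule finite_subset) simp
  ultimately have "card A = 0 \<longleftrightarrow> peelable (dim_row M) f {..<length xs}" by simp
  moreover have "hoare (holds_live M xs s\<^sub>0 {..<length xs}) (scans (length xs) (length xs))
    (length xs * scan_time (length xs) R + 1) (holds_live M xs s\<^sub>0 A)"
    unfolding A_def using n by (intro scans_correct) auto
  ultimately show "hoare (holds_live M xs s\<^sub>0 {..<length xs}) (scans (length xs) (length xs))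
    (length xs * scan_time (length xs) R + 1) (\<lambda>s. agree_outside {live, pos, left} s\<^sub>0 s \<and>
      (s left 0 = 0 \<longleftrightarrow> peelable (dim_row M) f {..<length xs}))"
    unfolding hoare_def holds_live_def by metis
qed

text \<open>Injectivity of \<open>(!) xs\<close> on the positions is distinctness of
  \<open>xs\<close>; this joins the two directions of the renaming argument.\<close>

lemma peelable_positions_iff:
  "peelable (dim_row M) f {..<length xs} \<longleftrightarrow> distinct xs \<and> indep_columns M (set xs)"
proof -
  have "(!) xs ` {..<length xs} = set xs" by (auto simp: set_conv_nth)
  moreover have "inj_on ((!) xs) {..<length xs} \<longleftrightarrow> distinct xs"
    by (auto simp: distinct_conv_nth inj_on_def)
  ultimately show ?thesis
    using peelable_compose_imp[of "dim_row M" "\<lambda>r c. M $$ (r, c)" "(!) xs" "{..<length xs}"]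
      peelable_imp_compose[of "dim_row M" "\<lambda>r c. M $$ (r, c)" "set xs" "(!) xs" "{..<length xs}"] cols
    unfolding f_def indep_columns_iff_peelable by metis
qed

lemmas test_correct = test_correct_peelable[unfolded peelable_positions_iff]

end

section \<open>Visiting all sets of columns of bounded size\<close>

text \<open>The case distinction is resolved when the program is built. The value is that of
  \<open>next_column\<close>: one more than the preceding stack cell.\<close>

definition first_column :: "nat \<Rightarrow> prog" where
  "first_column j = Write stack (Const j) (if j = 0 then Const 0 else Add (Read stack (Const (j - 1))) (Const 1))"

definition advance :: "nat \<Rightarrow> prog" where
  "advance j = Write stack (Const j) (Add (Read stack (Const j)) (Const 1))"

definition column_guard :: "nat \<Rightarrow> expr" where
  "column_guard j = Sub (var Num_Cols) (Read stack (Const j))"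

text \<open>The depth \<open>r\<close> is fixed, so recursion unfolds into \<open>r\<close> nested
  loops, each level with its own copy of the body for lists of its length.\<close>

primrec visit :: "(nat \<Rightarrow> prog) \<Rightarrow> nat \<Rightarrow> nat \<Rightarrow> prog" where
  "visit body 0 j = body j"
| "visit body (Suc r) j = Seq (body j) (Seq (first_column j)
     (While (column_guard j) (Seq (visit body r (Suc j)) (advance j))))"

primrec visit_time :: "(nat \<Rightarrow> nat) \<Rightarrow> nat \<Rightarrow> nat \<Rightarrow> nat \<Rightarrow> nat" where
  "visit_time t n 0 j = t j"
| "visit_time t n (Suc r) j = t j + (cost_prog (first_column j) +
     (n * (1 + cost_expr (column_guard j) + (visit_time t n r (Suc j) + cost_prog (advance j))) +
      (1 + cost_expr (column_guard j))))"

text \<open>\<open>I\<close> is indexed by the lists already treated, in order, so that a body can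
  tie its output to a position. The loop control itself writes only to \<open>stack\<close>, which
  the second premise covers.\<close>

lemma visit_correct:
  assumes body: "\<And>pre xs. sorted_wrt (<) xs \<Longrightarrow> set xs \<subseteq> {..<n} \<Longrightarrow>
      hoare (\<lambda>s. I pre s \<and> holds_stack xs s) (body (length xs)) (t (length xs))
        (\<lambda>s. I (pre @ [xs]) s \<and> holds_stack xs s)"
    and frame: "\<And>pre s g. I pre s \<Longrightarrow> I pre (s(stack := g))"
    and cols: "\<And>pre s. I pre s \<Longrightarrow> s Num_Cols 0 = n"
  shows "sorted_wrt (<) xs \<Longrightarrow> set xs \<subseteq> {..<n} \<Longrightarrow>
    hoare (\<lambda>s. I pre s \<and> holds_stack xs s) (visit body r (length xs)) (visit_time t n r (length xs))
      (\<lambda>s. I (pre @ extensions n r xs) s \<and> holds_stack xs s)"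
proof (induction r arbitrary: pre xs)
  case 0
  then show ?case using body by simp
next
  case (Suc r)
  let ?j = "length xs" and ?lo = "next_column xs"
  have lo: "?lo \<le> n" using subsetD[OF Suc.prems(2) last_in_set] by (auto simp: next_column_def Suc_le_eq)
  define visited where "visited i = (pre @ [xs]) @ concat (map (\<lambda>x. extensions n r (xs @ [x])) [?lo..<?lo + i])" for i
  let ?I = "\<lambda>i s. I (visited i) s \<and> holds_stack xs s \<and> s stack ?j = ?lo + i"
  have "hoare (\<lambda>s. I (pre @ [xs]) s \<and> holds_stack xs s) (first_column ?j) (cost_prog (first_column ?j)) (?I 0)"
    by (rule hoare_loop_free)
      (auto simp: first_column_def visited_def holds_stack_def next_column_def last_conv_nth intro!: frame)
  moreover have "hoare (?I 0) (While (column_guard ?j) (Seq (visit body r (Suc ?j)) (advance ?j)))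
     (n * (1 + cost_expr (column_guard ?j) + (visit_time t n r (Suc ?j) + cost_prog (advance ?j))) +
      (1 + cost_expr (column_guard ?j))) (?I (n - ?lo))"
  proof (rule hoare_While)
    fix i assume "i < n - ?lo"
    define x where "x = ?lo + i"
    have "y < x" if "y \<in> set xs" for y
    proof -
      have "y \<le> last xs"
        using that Suc.prems(1) by (induction xs) (auto split: if_splits intro: less_imp_le)
      moreover have "xs \<noteq> []" using that by auto
      ultimately show ?thesis by (simp add: x_def next_column_def)
    qed
    then have sorted: "sorted_wrt (<) (xs @ [x])" using Suc.prems(1) by (simp add: sorted_wrt_append)
    have bounded: "set (xs @ [x]) \<subseteq> {..<n}" using Suc.prems(2) \<open>i < n - ?lo\<close> by (auto simp: x_def)
    let ?Q = "\<lambda>s. I (visited i @ extensions n r (xs @ [x])) s \<and> holds_stack (xs @ [x]) s"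
    have "hoare (?I i) (visit body r (Suc ?j)) (visit_time t n r (Suc ?j)) ?Q"
      using Suc.IH[OF sorted bounded, of "visited i"] unfolding length_append_singleton
      by (rule hoare_conseq) (auto simp: holds_stack_def nth_append less_Suc_eq x_def)
    \<comment> \<open>The subtree leaves the first \<open>Suc ?j\<close> stack cells intact, so the
      increment continues from \<open>x\<close>.\<close>
    moreover have "hoare ?Q (advance ?j) (cost_prog (advance ?j)) (?I (Suc i))"
      by (rule hoare_loop_free)
        (auto simp: advance_def visited_def x_def holds_stack_def nth_append less_Suc_eq intro!: frame)
    ultimately show "hoare (?I i) (Seq (visit body r (Suc ?j)) (advance ?j))
        (visit_time t n r (Suc ?j) + cost_prog (advance ?j)) (?I (Suc i))"
      by (rule hoare_Seq)
  next
    fix i s assume "i \<le> n - ?lo" "?I i s"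
    then show "eval_expr (column_guard ?j) s \<noteq> 0 \<longleftrightarrow> i < n - ?lo"
      using cols lo by (auto simp: column_guard_def)
  qed simp
  ultimately have "hoare (\<lambda>s. I pre s \<and> holds_stack xs s) (visit body (Suc r) ?j) (visit_time t n (Suc r) ?j) (?I (n - ?lo))"
    using body[OF Suc.prems, of pre] unfolding visit.simps visit_time.simps by (intro hoare_Seq)
  then show ?case
    by (rule hoare_conseq) (use lo in \<open>auto simp: visited_def\<close>)
qed

declare extensions.simps(2) [simp del]

corollary visit_all_correct:
  assumes "\<And>pre xs. sorted_wrt (<) xs \<Longrightarrow> set xs \<subseteq> {..<n} \<Longrightarrow>
      hoare (\<lambda>s. I pre s \<and> holds_stack xs s) (body (length xs)) (t (length xs))
        (\<lambda>s. I (pre @ [xs]) s \<and> holds_stack xs s)"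
    and "\<And>pre s g. I pre s \<Longrightarrow> I pre (s(stack := g))"
    and "\<And>pre s. I pre s \<Longrightarrow> s Num_Cols 0 = n"
  shows "hoare (I []) (visit body r 0) (visit_time t n r 0) (I (extensions n r []))"
proof -
  have "hoare (\<lambda>s. I [] s \<and> holds_stack [] s) (visit body r (length ([] :: nat list)))
      (visit_time t n r (length ([] :: nat list)))
      (\<lambda>s. I ([] @ extensions n r []) s \<and> holds_stack [] s)"
    by (rule visit_correct) (use assms in \<open>simp_all del: fun_upd_apply\<close>)
  then show ?thesis by (simp add: holds_stack_def)
qed

section \<open>Listing the faces\<close>

abbreviation "face_end \<equiv> Work 5"

primrec copy_stack :: "nat \<Rightarrow> prog" where
  "copy_stack 0 = Skip"
| "copy_stack (Suc i) = Seq (copy_stack i)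
     (Write Faces (Add (var face_end) (Const (Suc i))) (Read stack (Const i)))"

definition append_face :: "nat \<Rightarrow> prog" where
  "append_face j = Seq (Write Faces (var face_end) (Const j)) (Seq (copy_stack j)
     (Seq (assign face_end (Add (var face_end) (Const (Suc j))))
          (assign Num_Faces (Add (var Num_Faces) (Const 1)))))"

definition record_face :: "nat \<Rightarrow> prog" where
  "record_face j = Seq (test j) (Cond (var left) Skip (append_face j))"

definition record_time :: "nat \<Rightarrow> nat \<Rightarrow> nat" where
  "record_time R j = test_time j R + (1 + cost_expr (var left) + cost_prog Skip + cost_prog (append_face j))"

definition indep_lists :: "bool mat \<Rightarrow> nat list list \<Rightarrow> nat list list" where
  "indep_lists M = filter (\<lambda>xs. indep_columns M (set xs))"

definition records :: "nat list list \<Rightarrow> nat list" where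
  "records L = concat (map (\<lambda>xs. length xs # xs) L)"

definition holds_faces :: "nat list list \<Rightarrow> store \<Rightarrow> bool" where
  "holds_faces L s \<longleftrightarrow> s Num_Faces 0 = length L \<and> (\<forall>i<length (records L). s Faces i = records L ! i)"

definition listing :: "bool mat \<Rightarrow> nat list list \<Rightarrow> store \<Rightarrow> bool" where
  "listing M pre s \<longleftrightarrow> holds_matrix M s \<and> holds_faces (indep_lists M pre) s \<and>
     s face_end 0 = length (records (indep_lists M pre))"

lemma loop_free_copy_stack [simp]: "loop_free (copy_stack i)" by (induction i) auto

lemma exec_copy_stack:
  "exec (copy_stack j) s = s(Faces := \<lambda>k. if s face_end 0 < k \<and> k \<le> s face_end 0 + j
     then s stack (k - s face_end 0 - 1) else s Faces k)"
  by (induction j) (auto simp: fun_eq_iff le_Suc_eq)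

text \<open>Lifts \<open>test\<close> from a single start state to any assertion that survives
  changes to its three scratch arrays.\<close>

lemma hoare_test:
  assumes P: "\<And>s. P s \<Longrightarrow> holds_matrix M s \<and> holds_stack xs s"
    and frame: "\<And>s s'. P s \<Longrightarrow> agree_outside {live, pos, left} s s' \<Longrightarrow> P s'"
    and "set xs \<subseteq> {..<dim_col M}" "dim_row M \<le> R" "0 < dim_col M"
  shows "hoare P (test (length xs)) (test_time (length xs) R)
    (\<lambda>s. P s \<and> (s left 0 = 0 \<longleftrightarrow> distinct xs \<and> indep_columns M (set xs)))"
  unfolding hoare_def
proof (intro allI impI)
  fix s assume s: "P s"
  have "hoare (\<lambda>s'. s' = s) (test (length xs)) (test_time (length xs) R)
    (\<lambda>s'. agree_outside {live, pos, left} s s' \<and> (s' left 0 = 0 \<longleftrightarrow> distinct xs \<and> indep_columns M (set xs)))"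
    using P[OF s] assms(3-5) by (intro test_correct) auto
  then obtain u s' where "run (test (length xs)) s u s'" "u \<le> test_time (length xs) R"
    "agree_outside {live, pos, left} s s'" "s' left 0 = 0 \<longleftrightarrow> distinct xs \<and> indep_columns M (set xs)"
    unfolding hoare_def by metis
  then show "\<exists>u s'. run (test (length xs)) s u s' \<and> u \<le> test_time (length xs) R \<and>
      P s' \<and> (s' left 0 = 0 \<longleftrightarrow> distinct xs \<and> indep_columns M (set xs))"
    using frame[OF s] by metis
qed

lemma records_append: "records (L @ L') = records L @ records L'"
  by (simp add: records_def)

lemma append_face_correct:
  assumes "indep_columns M (set xs)"
  shows "hoare (\<lambda>s. listing M pre s \<and> holds_stack xs s) (append_face (length xs)) (cost_prog (append_face (length xs)))
    (\<lambda>s. listing M (pre @ [xs]) s \<and> holds_stack xs s)"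
proof (rule hoare_loop_free, goal_cases)
  case (2 s)
  let ?s = "exec (append_face (length xs)) s" and ?w = "records (indep_lists M pre)"
  have L: "indep_lists M (pre @ [xs]) = indep_lists M pre @ [xs]"
    using assms by (simp add: indep_lists_def)
  have Faces: "?s Faces = (\<lambda>k. if length ?w < k \<and> k \<le> length ?w + length xs then s stack (k - length ?w - 1)
      else if k = length ?w then length xs else s Faces k)"
    using 2 by (auto simp: append_face_def exec_copy_stack listing_def)
  have cell: "?s Faces i = (?w @ length xs # xs) ! i" if i: "i < length ?w + Suc (length xs)" for i
  proof (cases i "length ?w" rule: linorder_cases)
    case less
    then show ?thesis using 2 unfolding Faces by (simp add: listing_def holds_faces_def nth_append)
  next
    case equal
    then show ?thesis unfolding Faces by simp
  next
    case greater
    then obtain k where "i = Suc (length ?w + k)" by (auto dest: less_imp_Suc_add)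
    then show ?thesis using 2 i unfolding Faces by (simp add: holds_stack_def nth_append)
  qed
  have "records (indep_lists M (pre @ [xs])) = ?w @ length xs # xs"
    unfolding L records_append by (simp add: records_def)
  moreover have "?s Num_Faces 0 = length (indep_lists M (pre @ [xs]))"
    unfolding L using 2 by (auto simp: append_face_def exec_copy_stack listing_def holds_faces_def)
  ultimately have "holds_faces (indep_lists M (pre @ [xs])) ?s"
    unfolding holds_faces_def using cell by (simp del: fun_upd_apply)
  moreover have "?s face_end 0 = length (records (indep_lists M (pre @ [xs])))"
    unfolding L records_append using 2
    by (auto simp: append_face_def exec_copy_stack listing_def records_def)
  moreover have "holds_matrix M ?s" "holds_stack xs ?s"
    using 2 by (auto simp: append_face_def exec_copy_stack listing_def holds_matrix_def holds_stack_def)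
  ultimately show ?case by (simp add: listing_def)
qed (simp add: append_face_def)

lemma record_face_correct:
  assumes "sorted_wrt (<) xs" "set xs \<subseteq> {..<dim_col M}" "dim_row M \<le> R" "0 < dim_col M"
  shows "hoare (\<lambda>s. listing M pre s \<and> holds_stack xs s) (record_face (length xs)) (record_time R (length xs))
    (\<lambda>s. listing M (pre @ [xs]) s \<and> holds_stack xs s)"
  unfolding record_face_def record_time_def
proof (rule hoare_Seq)
  have dist: "distinct xs" using assms(1) by (simp add: strict_sorted_iff)
  let ?P = "\<lambda>s. listing M pre s \<and> holds_stack xs s"
  let ?Q = "\<lambda>s. ?P s \<and> (s left 0 = 0 \<longleftrightarrow> distinct xs \<and> indep_columns M (set xs))"
  show "hoare ?P (test (length xs)) (test_time (length xs) R) ?Q"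
    using assms(2-4) by (intro hoare_test)
      (auto simp: listing_def holds_matrix_def holds_stack_def holds_faces_def agree_outside_def)
  show "hoare ?Q (Cond (var left) Skip (append_face (length xs)))
      (1 + cost_expr (var left) + cost_prog Skip + cost_prog (append_face (length xs)))
      (\<lambda>s. listing M (pre @ [xs]) s \<and> holds_stack xs s)"
  proof (rule hoare_Cond)
    show "hoare (\<lambda>s. ?Q s \<and> eval_expr (var left) s \<noteq> 0) Skip (cost_prog Skip)
        (\<lambda>s. listing M (pre @ [xs]) s \<and> holds_stack xs s)"
      using dist by (intro hoare_loop_free) (auto simp: listing_def indep_lists_def)
    show "hoare (\<lambda>s. ?Q s \<and> eval_expr (var left) s = 0) (append_face (length xs))
        (cost_prog (append_face (length xs))) (\<lambda>s. listing M (pre @ [xs]) s \<and> holds_stack xs s)"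
    proof (cases "indep_columns M (set xs)")
      case True
      then show ?thesis by (intro hoare_conseq[OF append_face_correct]) auto
    qed (auto simp: hoare_def)
  qed
qed

text \<open>The number of entries is a product, obtained by one addition per row; \<open>pos\<close>
  serves as the row counter here.\<close>

definition area_guard :: expr where
  "area_guard = Sub (var Num_Rows) (var pos)"

definition area_step :: prog where
  "area_step = Seq (assign area (Add (var area) (var Num_Cols))) (assign pos (Add (var pos) (Const 1)))"

definition list_faces :: "nat \<Rightarrow> prog" where
  "list_faces d = Seq (While area_guard area_step) (visit record_face (Suc d) 0)"

definition list_time :: "nat \<Rightarrow> nat \<Rightarrow> nat \<Rightarrow> nat" where
  "list_time d R n = (R * (1 + cost_expr area_guard + cost_prog area_step) + (1 + cost_expr area_guard)) +
     visit_time (record_time R) n (Suc d) 0"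

lemma list_faces_correct:
  assumes "dim_row M \<le> R" "0 < dim_col M"
  shows "hoare (\<lambda>s. s = input_store M) (list_faces d) (list_time d R (dim_col M))
    (listing M (extensions (dim_col M) (Suc d) []))"
  unfolding list_faces_def list_time_def
proof (rule hoare_Seq)
  let ?I = "\<lambda>r s. s Num_Rows 0 = dim_row M \<and> s Num_Cols 0 = dim_col M \<and> s Entries = input_store M Entries \<and>
     s Num_Faces 0 = 0 \<and> s face_end 0 = 0 \<and> s area 0 = r * dim_col M \<and> s pos 0 = r"
  have "hoare (?I 0) (While area_guard area_step)
      (R * (1 + cost_expr area_guard + cost_prog area_step) + (1 + cost_expr area_guard)) (?I (dim_row M))"
  proof (rule hoare_While)
    fix r assume "r < dim_row M"
    show "hoare (?I r) area_step (cost_prog area_step) (?I (Suc r))"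
      by (rule hoare_loop_free) (auto simp: area_step_def)
  qed (use assms in \<open>auto simp: area_guard_def\<close>)
  \<comment> \<open>All scratch cells of the input are 0, which is the invariant at
    \<open>r = 0\<close>.\<close>
  then show "hoare (\<lambda>s. s = input_store M) (While area_guard area_step)
      (R * (1 + cost_expr area_guard + cost_prog area_step) + (1 + cost_expr area_guard)) (listing M [])"
    by (rule hoare_conseq)
      (auto simp: input_store_def listing_def holds_matrix_def holds_faces_def indep_lists_def records_def)
  show "hoare (listing M []) (visit record_face (Suc d) 0) (visit_time (record_time R) (dim_col M) (Suc d) 0)
      (listing M (extensions (dim_col M) (Suc d) []))"
    using assms by (intro visit_all_correct record_face_correct)
      (auto simp: listing_def holds_matrix_def holds_faces_def)
qed

section \<open>Marking the facets\<close>

abbreviation "mark_count \<equiv> Work 6"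

text \<open>A face counts as a facet until an extension is found. The stack cell behind the face
  holds the candidate column.\<close>

definition init_mark :: "nat \<Rightarrow> prog" where
  "init_mark j = Seq (Write Marks (var mark_count) (Const 1)) (Write stack (Const j) (Const 0))"

definition clear_mark :: "nat \<Rightarrow> prog" where
  "clear_mark j = Seq (Cond (var left) Skip (Write Marks (var mark_count) (Const 0))) (advance j)"

definition mark_step :: "nat \<Rightarrow> prog" where
  "mark_step j = Seq (test (Suc j)) (clear_mark j)"

definition next_mark :: prog where
  "next_mark = assign mark_count (Add (var mark_count) (Const 1))"

text \<open>The loop also tries the columns of the face itself. A list with a repeated column fails the
  test.\<close>

definition mark_face :: "nat \<Rightarrow> prog" where
  "mark_face j = Seq (test j)
     (Cond (var left) Skip (Seq (init_mark j) (Seq (While (column_guard j) (mark_step j)) next_mark)))"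

definition mark_time :: "nat \<Rightarrow> nat \<Rightarrow> nat \<Rightarrow> nat" where
  "mark_time R n j = test_time j R + (1 + cost_expr (var left) + cost_prog Skip + (cost_prog (init_mark j) +
     ((n * (1 + cost_expr (column_guard j) + (test_time (Suc j) R + cost_prog (clear_mark j))) +
       (1 + cost_expr (column_guard j))) + cost_prog next_mark)))"

text \<open>The bound \<open>v\<close> describes the marking loop after the candidates below
  \<open>v\<close>.\<close>

definition extendable :: "bool mat \<Rightarrow> nat \<Rightarrow> nat list \<Rightarrow> bool" where
  "extendable M v xs \<longleftrightarrow> (\<exists>c<v. c \<notin> set xs \<and> indep_columns M (insert c (set xs)))"

text \<open>\<open>L\<close> is the stored list, \<open>pre\<close> what this pass has visited;
  \<open>mark_count\<close> points to the next mark, which lies outside the range described here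
  while it is being computed.\<close>

definition marking :: "bool mat \<Rightarrow> nat list list \<Rightarrow> nat list list \<Rightarrow> store \<Rightarrow> bool" where
  "marking M L pre s \<longleftrightarrow> holds_matrix M s \<and> holds_faces L s \<and> s mark_count 0 = length (indep_lists M pre) \<and>
     (\<forall>i<length (indep_lists M pre). s Marks i = of_bool (\<not> extendable M (dim_col M) (indep_lists M pre ! i)))"

lemma mark_step_correct:
  assumes "set xs \<subseteq> {..<dim_col M}" "distinct xs" "dim_row M \<le> R" "v < dim_col M"
  shows "hoare
    (\<lambda>s. marking M L pre s \<and> holds_stack (xs @ [v]) s \<and>
       s Marks (length (indep_lists M pre)) = of_bool (\<not> extendable M v xs))
    (mark_step (length xs)) (test_time (Suc (length xs)) R + cost_prog (clear_mark (length xs)))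
    (\<lambda>s. marking M L pre s \<and> holds_stack (xs @ [Suc v]) s \<and>
       s Marks (length (indep_lists M pre)) = of_bool (\<not> extendable M (Suc v) xs))"
  unfolding mark_step_def
proof (rule hoare_Seq)
  let ?P = "\<lambda>v s. marking M L pre s \<and> holds_stack (xs @ [v]) s \<and>
       s Marks (length (indep_lists M pre)) = of_bool (\<not> extendable M v xs)"
  let ?Q = "\<lambda>s. ?P v s \<and> (s left 0 = 0 \<longleftrightarrow> distinct (xs @ [v]) \<and> indep_columns M (set (xs @ [v])))"
  have "hoare (?P v) (test (length (xs @ [v]))) (test_time (length (xs @ [v])) R) ?Q"
    by (rule hoare_test)
      (use assms in \<open>auto simp: marking_def holds_matrix_def holds_stack_def holds_faces_def agree_outside_def\<close>)
  then show "hoare (?P v) (test (Suc (length xs))) (test_time (Suc (length xs)) R) ?Q" by simp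
  \<comment> \<open>Distinctness excludes candidates from the face itself, so they leave the mark
    unchanged.\<close>
  have ext: "extendable M (Suc v) xs \<longleftrightarrow> extendable M v xs \<or> distinct (xs @ [v]) \<and> indep_columns M (set (xs @ [v]))"
    using assms(2) by (auto simp: extendable_def less_Suc_eq)
  show "hoare ?Q (clear_mark (length xs)) (cost_prog (clear_mark (length xs))) (?P (Suc v))"
    unfolding ext
    by (rule hoare_loop_free)
      (auto simp: clear_mark_def advance_def marking_def holds_matrix_def holds_faces_def
        holds_stack_def nth_append less_Suc_eq)
qed

lemma mark_face_correct:
  assumes "sorted_wrt (<) xs" "set xs \<subseteq> {..<dim_col M}" "dim_row M \<le> R" "0 < dim_col M"
  shows "hoare (\<lambda>s. marking M L pre s \<and> holds_stack xs s) (mark_face (length xs))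
    (mark_time R (dim_col M) (length xs)) (\<lambda>s. marking M L (pre @ [xs]) s \<and> holds_stack xs s)"
  unfolding mark_face_def mark_time_def
proof (rule hoare_Seq)
  have dist: "distinct xs" using assms(1) by (simp add: strict_sorted_iff)
  let ?j = "length xs"
  let ?P = "\<lambda>s. marking M L pre s \<and> holds_stack xs s"
  let ?Q = "\<lambda>s. ?P s \<and> (s left 0 = 0 \<longleftrightarrow> distinct xs \<and> indep_columns M (set xs))"
  let ?R = "\<lambda>s. marking M L (pre @ [xs]) s \<and> holds_stack xs s"
  let ?I = "\<lambda>v s. marking M L pre s \<and> holds_stack (xs @ [v]) s \<and>
       s Marks (length (indep_lists M pre)) = of_bool (\<not> extendable M v xs)"
  show "hoare ?P (test ?j) (test_time ?j R) ?Q"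
    using assms(2-4) by (intro hoare_test)
      (auto simp: marking_def holds_matrix_def holds_stack_def holds_faces_def agree_outside_def)
  show "hoare ?Q (Cond (var left) Skip (Seq (init_mark ?j) (Seq (While (column_guard ?j) (mark_step ?j)) next_mark)))
     (1 + cost_expr (var left) + cost_prog Skip + (cost_prog (init_mark ?j) +
     ((dim_col M * (1 + cost_expr (column_guard ?j) + (test_time (Suc ?j) R + cost_prog (clear_mark ?j))) +
       (1 + cost_expr (column_guard ?j))) + cost_prog next_mark))) ?R"
  proof (rule hoare_Cond)
    show "hoare (\<lambda>s. ?Q s \<and> eval_expr (var left) s \<noteq> 0) Skip (cost_prog Skip) ?R"
      using dist by (intro hoare_loop_free) (auto simp: marking_def indep_lists_def)
    show "hoare (\<lambda>s. ?Q s \<and> eval_expr (var left) s = 0)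
      (Seq (init_mark ?j) (Seq (While (column_guard ?j) (mark_step ?j)) next_mark))
      (cost_prog (init_mark ?j) +
       ((dim_col M * (1 + cost_expr (column_guard ?j) + (test_time (Suc ?j) R + cost_prog (clear_mark ?j))) +
         (1 + cost_expr (column_guard ?j))) + cost_prog next_mark)) ?R"
    proof (cases "indep_columns M (set xs)")
      case True
      show ?thesis
      proof (intro hoare_Seq)
        show "hoare (\<lambda>s. ?Q s \<and> eval_expr (var left) s = 0) (init_mark ?j) (cost_prog (init_mark ?j)) (?I 0)"
          by (rule hoare_loop_free)
            (auto simp: init_mark_def extendable_def marking_def holds_matrix_def holds_faces_def
              holds_stack_def nth_append less_Suc_eq)
        show "hoare (?I 0) (While (column_guard ?j) (mark_step ?j))
          (dim_col M * (1 + cost_expr (column_guard ?j) + (test_time (Suc ?j) R + cost_prog (clear_mark ?j))) +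
           (1 + cost_expr (column_guard ?j))) (?I (dim_col M))"
        proof (rule hoare_While)
          fix v assume "v < dim_col M"
          then show "hoare (?I v) (mark_step ?j) (test_time (Suc ?j) R + cost_prog (clear_mark ?j)) (?I (Suc v))"
            using assms dist by (intro mark_step_correct)
        qed (auto simp: column_guard_def marking_def holds_matrix_def holds_stack_def nth_append)
        have "indep_lists M (pre @ [xs]) = indep_lists M pre @ [xs]"
          using True by (simp add: indep_lists_def)
        then show "hoare (?I (dim_col M)) next_mark (cost_prog next_mark) ?R"
          unfolding marking_def
          by (intro hoare_loop_free)
            (auto simp: next_mark_def marking_def holds_matrix_def holds_faces_def
              holds_stack_def nth_append less_Suc_eq)
      qed
    qed (auto simp: hoare_def)
  qed
qed

text \<open>The traversal is repeated instead of reading back the stored records: independent lists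
  come in the same order, so \<open>mark_count\<close> runs parallel to the stored list.\<close>

definition mark_facets :: "nat \<Rightarrow> prog" where
  "mark_facets d = Seq (assign mark_count (Const 0)) (visit mark_face (Suc d) 0)"

definition facets_time :: "nat \<Rightarrow> nat \<Rightarrow> nat \<Rightarrow> nat" where
  "facets_time d R n = cost_prog (assign mark_count (Const 0)) + visit_time (mark_time R n) n (Suc d) 0"

lemma mark_facets_correct:
  assumes "dim_row M \<le> R" "0 < dim_col M"
  shows "hoare (\<lambda>s. holds_matrix M s \<and> holds_faces L s) (mark_facets d) (facets_time d R (dim_col M))
    (marking M L (extensions (dim_col M) (Suc d) []))"
  unfolding mark_facets_def facets_time_def
proof (rule hoare_Seq)
  show "hoare (\<lambda>s. holds_matrix M s \<and> holds_faces L s) (assign mark_count (Const 0))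
      (cost_prog (assign mark_count (Const 0))) (marking M L [])"
    by (rule hoare_loop_free) (auto simp: marking_def holds_matrix_def holds_faces_def indep_lists_def)
  show "hoare (marking M L []) (visit mark_face (Suc d) 0) (visit_time (mark_time R (dim_col M)) (dim_col M) (Suc d) 0)
      (marking M L (extensions (dim_col M) (Suc d) []))"
    using assms by (intro visit_all_correct mark_face_correct)
      (auto simp: marking_def holds_matrix_def holds_faces_def)
qed

section \<open>Running times\<close>

definition poly_bounded :: "nat \<Rightarrow> (nat \<Rightarrow> nat) \<Rightarrow> bool" where
  "poly_bounded k f \<longleftrightarrow> (\<lambda>n. real (f n)) \<in> O(\<lambda>n. real n ^ k)"

lemma poly_bounded_mono: "poly_bounded k f \<Longrightarrow> k \<le> l \<Longrightarrow> poly_bounded l f"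
proof -
  assume f: "poly_bounded k f" and "k \<le> l"
  have "(\<lambda>n. real n ^ k) \<in> O(\<lambda>n. real n ^ l)"
    using \<open>k \<le> l\<close> by (intro bigoI[of _ 1] eventually_sequentiallyI[of 1]) (auto intro: power_increasing)
  then show ?thesis using f landau_o.big_trans unfolding poly_bounded_def by blast
qed

lemma poly_bounded_add: "poly_bounded k f \<Longrightarrow> poly_bounded k g \<Longrightarrow> poly_bounded k (\<lambda>n. f n + g n)"
  by (simp add: poly_bounded_def sum_in_bigo)

lemma poly_bounded_const: "poly_bounded k (\<lambda>n. c)"
  by (rule poly_bounded_mono[of 0]) (auto simp: poly_bounded_def)

lemma poly_bounded_mult: "poly_bounded k f \<Longrightarrow> poly_bounded l g \<Longrightarrow> poly_bounded (k + l) (\<lambda>n. f n * g n)"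
  by (simp add: poly_bounded_def power_add landau_o.big.mult)

lemma poly_bounded_const_mult: "poly_bounded k f \<Longrightarrow> poly_bounded k (\<lambda>n. c * f n)"
  using poly_bounded_mult[OF poly_bounded_const[of 0]] by simp

lemma poly_bounded_mult_const: "poly_bounded k f \<Longrightarrow> poly_bounded k (\<lambda>n. f n * c)"
  using poly_bounded_const_mult by (simp add: mult.commute)

lemma poly_bounded_times_id: "poly_bounded k f \<Longrightarrow> poly_bounded (Suc k) (\<lambda>n. n * f n)"
  using poly_bounded_mult[of 1 "\<lambda>n. n" k f] by (simp add: poly_bounded_def)

lemma poly_bounded_power_sum: "poly_bounded d (\<lambda>n. \<Sum>i\<le>d. n ^ i)"
proof -
  have "poly_bounded d (\<lambda>n. \<Sum>i\<le>l. n ^ i)" if "l \<le> d" for l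
    using that
  proof (induction l)
    case 0
    then show ?case by (simp add: poly_bounded_const)
  next
    case (Suc l)
    have "poly_bounded (Suc l) (\<lambda>n. n ^ Suc l)" by (simp add: poly_bounded_def)
    then have "poly_bounded d (\<lambda>n. n ^ Suc l)" using Suc.prems by (rule poly_bounded_mono)
    then show ?case using Suc by (simp add: poly_bounded_add)
  qed
  then show ?thesis by simp
qed

lemmas poly_bounded_intros = poly_bounded_add poly_bounded_const poly_bounded_const_mult poly_bounded_mult_const

text \<open>Each of the \<open>r\<close> nested loops makes at most \<open>n\<close> rounds and
  raises the degree by one.\<close>

lemma poly_bounded_visit_time:
  assumes "\<And>j. poly_bounded k (\<lambda>n. t n j)"
  shows "poly_bounded (r + k) (\<lambda>n. visit_time (t n) n r j)"
proof (induction r arbitrary: j)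
  case 0
  then show ?case using assms by simp
next
  case (Suc r)
  have "poly_bounded (Suc (r + k)) (\<lambda>n. t n j)" using assms by (rule poly_bounded_mono) simp
  then show ?case using Suc
    unfolding visit_time.simps add_Suc by (intro poly_bounded_intros poly_bounded_times_id)
qed

lemma poly_bounded_test_time: "poly_bounded k R \<Longrightarrow> poly_bounded k (\<lambda>n. test_time j (R n))"
  unfolding test_time_def scan_time_def by (intro poly_bounded_intros)

lemma poly_bounded_list_time:
  assumes "poly_bounded k R"
  shows "poly_bounded (Suc d + k) (\<lambda>n. list_time d (R n) n)"
proof -
  have "poly_bounded (Suc d + k) R" using assms by (rule poly_bounded_mono) simp
  moreover have "poly_bounded k (\<lambda>n. record_time (R n) j)" for j
    unfolding record_time_def using assms by (intro poly_bounded_intros poly_bounded_test_time)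
  ultimately show ?thesis
    unfolding list_time_def by (intro poly_bounded_intros poly_bounded_visit_time)
qed

lemma poly_bounded_facets_time:
  assumes "poly_bounded k R"
  shows "poly_bounded (Suc d + Suc k) (\<lambda>n. facets_time d (R n) n)"
proof -
  have "poly_bounded (Suc k) (\<lambda>n. mark_time (R n) n j)" for j
    unfolding mark_time_def using assms poly_bounded_mono[OF assms, of "Suc k"]
    by (intro poly_bounded_intros poly_bounded_times_id poly_bounded_test_time) auto
  then show ?thesis
    unfolding facets_time_def by (intro poly_bounded_intros poly_bounded_visit_time)
qed

section \<open>Facets and faces of the complex\<close>

text \<open>By closure under subsets, a strictly larger face contains a face with just one more
  column.\<close>

lemma facet_iff_not_extendable:
  assumes "defines_complex M V H" "indep_columns M (set xs)"
  shows "facet H (set xs) \<longleftrightarrow> \<not> extendable M (dim_col M) xs"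
proof
  have H: "H = {X. indep_columns M X}" and closed: "\<And>I J. I \<in> H \<Longrightarrow> J \<subseteq> I \<Longrightarrow> J \<in> H"
    using assms(1) by (auto simp: defines_complex_def simplicial_complex_def)
  show "\<not> extendable M (dim_col M) xs" if "facet H (set xs)"
    using that unfolding facet_def extendable_def H by blast
  show "facet H (set xs)" if no: "\<not> extendable M (dim_col M) xs"
    unfolding facet_def
  proof (intro conjI ballI impI)
    show "set xs \<in> H" using assms(2) H by simp
    fix G assume G: "G \<in> H" "set xs \<subseteq> G"
    have "c \<in> set xs" if "c \<in> G" for c
    proof (rule ccontr)
      assume "c \<notin> set xs"
      moreover have "insert c (set xs) \<in> H" using closed[OF G(1)] G(2) that by blast
      moreover have "c < dim_col M" using G(1) that by (auto simp: H indep_columns_def)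
      ultimately show False using no by (auto simp: extendable_def H)
    qed
    then show "G = set xs" using G(2) by blast
  qed
qed

lemma card_face_le:
  assumes "defines_complex M V H" "complex_dim H = int d" "indep_columns M X"
  shows "card X \<le> Suc d"
proof -
  have "H \<subseteq> Pow V" "finite V" "X \<in> H"
    using assms(1,3) by (auto simp: defines_complex_def simplicial_complex_def)
  then have "finite H" "X \<in> H" by (auto intro: finite_subset)
  then have "face_dim X \<le> complex_dim H" unfolding complex_dim_def by (intro Max_ge) auto
  then show ?thesis using assms(2) by (simp add: face_dim_def)
qed

text \<open>With this bound on cardinalities, depth \<open>Suc d\<close> reaches the increasing
  enumeration of every independent set.\<close>

lemma set_faces:
  assumes "\<And>X. indep_columns M X \<Longrightarrow> card X \<le> Suc d"
  shows "set ` set (indep_lists M (extensions (dim_col M) (Suc d) [])) = {X. indep_columns M X}"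
proof (intro equalityI subsetI)
  fix X assume "X \<in> {X. indep_columns M X}"
  then have X: "indep_columns M X" "X \<subseteq> {..<dim_col M}" "finite X"
    by (auto simp: indep_columns_def intro: finite_subset)
  then have "sorted_list_of_set X \<in> set (indep_lists M (extensions (dim_col M) (Suc d) []))"
    using assms[OF X(1)] by (auto simp: indep_lists_def set_extensions next_column_def)
  then show "X \<in> set ` set (indep_lists M (extensions (dim_col M) (Suc d) []))"
    using X(3) by (metis image_eqI set_sorted_list_of_set)
qed (auto simp: indep_lists_def)

lemma encode_face_set: "sorted_wrt (<) xs \<Longrightarrow> encode_face (set xs) = length xs # xs"
  by (simp add: encode_face_def strict_sorted_iff distinct_card sorted_list_of_set.idem_if_sorted_distinct)

theorem theorem7p3:
  fixes d :: nat
  shows "\<exists>(list_faces :: prog) (mark_facets :: prog) (T :: nat \<Rightarrow> nat) (T' :: nat \<Rightarrow> nat).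
    (\<lambda>n. real (T n)) \<in> O(\<lambda>n. real n ^ (2 * d + 1)) \<and>
    (\<lambda>n. real (T' n)) \<in> O(\<lambda>n. real n ^ (2 * d + 2)) \<and>
    (\<forall>(M :: bool mat) (n :: nat) (V :: nat set) (H :: nat set set).
       reduced M \<and> dim_col M = n \<and> defines_complex M V H \<and> complex_dim H = int d \<longrightarrow>
       (\<exists>(L :: nat set list) t s t' s'.
          run list_faces (input_store M) t s \<and> t \<le> T n \<and>
          distinct L \<and> set L = H \<and> stores_faces s L \<and>
          run mark_facets s t' s' \<and> t' \<le> T' n \<and>
          stores_faces s' L \<and> stores_marks s' H L))"
proof (rule exI[of _ "list_faces d"], rule exI[of _ "mark_facets d"],
    rule exI[of _ "\<lambda>n. list_time d (\<Sum>i\<le>d. n ^ i) n"],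
    rule exI[of _ "\<lambda>n. facets_time d (\<Sum>i\<le>d. n ^ i) n"], intro conjI allI impI)
  \<comment> \<open>Degree \<open>Suc d\<close> comes from the nested loops and \<open>d\<close>
    from the number of rows; below, the candidate columns add one more.\<close>
  show "(\<lambda>n. real (list_time d (\<Sum>i\<le>d. n ^ i) n)) \<in> O(\<lambda>n. real n ^ (2 * d + 1))"
    using poly_bounded_list_time[OF poly_bounded_power_sum[of d], of d]
    by (simp add: poly_bounded_def mult_2)
  show "(\<lambda>n. real (facets_time d (\<Sum>i\<le>d. n ^ i) n)) \<in> O(\<lambda>n. real n ^ (2 * d + 2))"
    using poly_bounded_facets_time[OF poly_bounded_power_sum[of d], of d]
    by (simp add: poly_bounded_def mult_2)
  fix M :: "bool mat" and n V H
  assume "reduced M \<and> dim_col M = n \<and> defines_complex M V H \<and> complex_dim H = int d"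
  then have red: "reduced M" and n: "dim_col M = n" and cplx: "defines_complex M V H"
    and dim: "complex_dim H = int d" by auto
  \<comment> \<open>A complex has a nonempty vertex set, hence there is a column.\<close>
  have H: "H = {X. indep_columns M X}" and pos: "0 < dim_col M"
    using cplx by (auto simp: defines_complex_def simplicial_complex_def)
  have card: "\<And>X. indep_columns M X \<Longrightarrow> card X \<le> Suc d" using card_face_le[OF cplx dim] .
  have rows: "dim_row M \<le> (\<Sum>i\<le>d. n ^ i)" using reduced_dim_row_le[OF red card] n by simp
  define Ls where "Ls = indep_lists M (extensions n (Suc d) [])"
  have sorted: "sorted_wrt (<) xs" if "xs \<in> set Ls" for xs
    using that by (auto simp: Ls_def indep_lists_def set_extensions)
  have encode: "concat (map encode_face (map set Ls)) = records Ls"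
    using sorted unfolding records_def by (simp add: encode_face_set cong: map_cong)
  have faces: "stores_faces s (map set Ls)" if "holds_faces Ls s" for s
    using that unfolding stores_faces_def holds_faces_def encode Let_def by simp
  obtain t s where s: "run (list_faces d) (input_store M) t s" "t \<le> list_time d (\<Sum>i\<le>d. n ^ i) n"
    "listing M (extensions n (Suc d) []) s"
    using list_faces_correct[OF rows pos, of d] n unfolding hoare_def by auto
  then have "holds_matrix M s \<and> holds_faces Ls s" by (simp add: listing_def Ls_def)
  moreover from this obtain t' s' where s': "run (mark_facets d) s t' s'" "t' \<le> facets_time d (\<Sum>i\<le>d. n ^ i) n"
    "marking M Ls (extensions n (Suc d) []) s'"
    using mark_facets_correct[OF rows pos, of Ls d] n unfolding hoare_def by auto
  moreover from s'(3) have "holds_faces Ls s'"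
    "\<forall>i<length Ls. s' Marks i = of_bool (\<not> extendable M n (Ls ! i))"
    using n by (auto simp: marking_def Ls_def)
  moreover have "facet H (set (Ls ! i)) \<longleftrightarrow> \<not> extendable M n (Ls ! i)" if "i < length Ls" for i
  proof -
    have "indep_columns M (set (Ls ! i))"
      using nth_mem[OF that] by (simp add: Ls_def indep_lists_def)
    then show ?thesis using facet_iff_not_extendable[OF cplx] n by simp
  qed
  moreover have "distinct (map set Ls)"
    using sorted distinct_extensions[of n "Suc d" "[]"]
    by (intro distinct_map_set_sorted) (simp_all add: Ls_def indep_lists_def)
  moreover have "set (map set Ls) = H"
    using set_faces[of M d] card n by (simp add: Ls_def H)
  ultimately show "\<exists>(L :: nat set list) t s t' s'.
          run (list_faces d) (input_store M) t s \<and> t \<le> list_time d (\<Sum>i\<le>d. n ^ i) n \<and>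
          distinct L \<and> set L = H \<and> stores_faces s L \<and>
          run (mark_facets d) s t' s' \<and> t' \<le> facets_time d (\<Sum>i\<le>d. n ^ i) n \<and>
          stores_faces s' L \<and> stores_marks s' H L"
    using s(1,2) faces
    by (intro exI[of _ "map set Ls"] exI[of _ t] exI[of _ s] exI[of _ t'] exI[of _ s'])
      (simp add: stores_marks_def)
qed

end
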